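(* Let $\{G_i\}_{i\ge1}$ be a sequence of finite abelian groups and $H_i,K_i$ subgroups of $G_i$ with $|H_i|,|K_i|,|G_i|\to\infty$. Let $$S_i=\{(x,x+a,x+b,x+a+b):\ x\in G_i,\ a\in H_i,\ b\in K_i\}\subseteq G_i^4,$$ and let $S_i^{(4)}$ be the set of elements of $S_i$ with pairwise distinct coordinates. Assume $\max\{|H_i|,|K_i|\}\le(|S_i^{(4)}|/|G_i|)^{2/3}$ for all $i$. Then for each $\delta$ with $0<\delta<1/40$ there exist $C=C(\delta)$ and $i_0$ (depending on the family $\{(G_i,H_i,K_i)\}$ and on $\delta$) such that for every $i\ge i_0$ and every integer $$t>\frac{C}{\delta}\left(\frac{|G_i|^4}{|S_i^{(4)}|}\right)^{1/3},$$ the number of subsets $X\subseteq G_i$ with $|X|=t$ and $X^4\cap S_i^{(4)}=\emptyset$ is at most $\binom{2\delta|G_i|}{t}$. *)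

theory Defs
  imports Complex_Main "HOL-Algebra.Coset"
begin

definition parallelograms ::
    "('a, 'm) monoid_scheme \<Rightarrow> 'a set \<Rightarrow> 'a set \<Rightarrow> ('a \<times> 'a \<times> 'a \<times> 'a) set" where
  "parallelograms G H K =
     {(x, x \<otimes>\<^bsub>G\<^esub> a, x \<otimes>\<^bsub>G\<^esub> b, x \<otimes>\<^bsub>G\<^esub> a \<otimes>\<^bsub>G\<^esub> b) | x a b.
        x \<in> carrier G \<and> a \<in> H \<and> b \<in> K}"

definition distinct_tuples ::
    "('a \<times> 'a \<times> 'a \<times> 'a) set \<Rightarrow> ('a \<times> 'a \<times> 'a \<times> 'a) set" where
  "distinct_tuples S = {(x, y, z, w). (x, y, z, w) \<in> S \<and> distinct [x, y, z, w]}"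

definition avoiding_sets ::
    "'a set \<Rightarrow> ('a \<times> 'a \<times> 'a \<times> 'a) set \<Rightarrow> nat \<Rightarrow> 'a set set" where
  "avoiding_sets V S t =
     {X. X \<subseteq> V \<and> card X = t \<and> (X \<times> X \<times> X \<times> X) \<inter> S = {}}"

(* Binomial coefficient with a real upper entry, which is rounded down. Thus it is 0 for t > x \<ge> 0,
   whereas the polynomial extension x gchoose t can be negative there. *)
definition floor_choose :: "real \<Rightarrow> nat \<Rightarrow> nat" where
  "floor_choose x t = nat \<lfloor>x\<rfloor> choose t"

end

theory Submission
  imports Defs "HOL-Analysis.Convex"
begin

text \<open>
  The sets to be counted are encoded by small fingerprints, in the manner of Kleitman and Winston.
  Let \<open>n = |G|\<close> and \<open>s \<approx> n / (|H| |K|)\<^bsup>1/3\<^esup>\<close>. Two applications of the Cauchy-Schwarz inequality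
  show that every \<open>A \<subseteq> G\<close> with \<open>|A| \<ge> \<delta> n / 16\<close> spans a positive proportion of all parallelograms
  \<open>(x, z, y, w)\<close>, with sides \<open>x z\<close> and \<open>y w\<close> in cosets of \<open>H\<close> and \<open>x y\<close> and \<open>z w\<close> in cosets of
  \<open>K\<close>. Given a parallelogram-free \<open>X \<subseteq> A\<close>, pick \<open>s\<close> elements of \<open>X\<close> that are the
  vertex \<open>x\<close> of many parallelograms, then \<open>s\<close> elements that are the vertex \<open>z\<close> of many
  parallelograms starting at a picked \<open>x\<close>, and finally \<open>O(s)\<close> elements \<open>y\<close>. The fourth vertices
  \<open>w\<close> of the resulting parallelograms are then a positive proportion of \<open>G\<close>, and none of them lies
  in \<open>X\<close>. If one of the picks is impossible, then \<open>X\<close> avoids, up to the elements already picked,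
  the many candidates for this pick. In either case the picked elements determine a set \<open>A'\<close> with
  \<open>|A'| \<le> |A| - c n\<close> that contains the rest of \<open>X\<close>. After boundedly many rounds what is left of
  \<open>X\<close> lies in a set of size at most \<open>\<delta> n / 16\<close>, and since \<open>O(s)\<close> is a small fraction of \<open>t\<close>, the
  number of fingerprints is exponentially small compared to the gain in the binomial coefficient.
\<close>

section \<open>Counting sets through fingerprints\<close>

text \<open>The expansion of \<open>(1 + w) ^ n\<close>, cut off after degree \<open>s\<close>. It
  is the price of one pick of at most \<open>s\<close> elements out of \<open>n\<close> when every
  picked element has weight \<open>w\<close>.\<close>

definition weight_sum :: "nat \<Rightarrow> nat \<Rightarrow> real \<Rightarrow> real" where
  "weight_sum n s w = (\<Sum>i\<le>s. real (n choose i) * w ^ i)"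

lemma weight_sum_ge_1: "0 \<le> w \<Longrightarrow> 1 \<le> weight_sum n s w"
  unfolding weight_sum_def sum.atMost_shift
  by (simp add: sum_nonneg)

lemma sum_small_subsets:
  fixes w :: real
  assumes "finite V"
  shows "(\<Sum>f | f \<subseteq> V \<and> card f \<le> s. w ^ card f) = weight_sum (card V) s w"
proof -
  have "(\<Sum>f | f \<subseteq> V \<and> card f \<le> s. w ^ card f)
      = (\<Sum>i\<le>s. \<Sum>f\<in>{f \<in> {f. f \<subseteq> V \<and> card f \<le> s}. card f = i}. w ^ card f)"
    by (rule sum.group[symmetric]) (use assms in auto)
  also have "\<dots> = weight_sum (card V) s w"
    unfolding weight_sum_def
  proof (rule sum.cong[OF refl])
    fix i assume "i \<in> {..s}"
    then have "{f \<in> {f. f \<subseteq> V \<and> card f \<le> s}. card f = i} = {f. f \<subseteq> V \<and> card f = i}"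
      by auto
    then show "(\<Sum>f\<in>{f \<in> {f. f \<subseteq> V \<and> card f \<le> s}. card f = i}. w ^ card f)
        = real (card V choose i) * w ^ i"
      using n_subsets[OF assms, of i] by simp
  qed
  finally show ?thesis .
qed

text \<open>From \<open>n choose i \<le> n ^ i / fact i\<close>, pulling out
  \<open>l ^ i \<le> l ^ s\<close> leaves a partial sum of the exponential series at
  \<open>n * w / l\<close>. A large \<open>l\<close> makes the exponential harmless, and
  \<open>l ^ s\<close> stays cheap because \<open>s\<close> is small.\<close>

lemma weight_sum_le_exp:
  fixes w l :: real
  assumes "0 \<le> w" "1 \<le> l"
  shows "weight_sum n s w \<le> l ^ s * exp (real n * w / l)"
proof -
  define z where "z = real n * w / l"
  have z: "0 \<le> z" using assms by (simp add: z_def)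
  have "weight_sum n s w \<le> (\<Sum>i\<le>s. l ^ s * (z ^ i / fact i))"
    unfolding weight_sum_def
  proof (rule sum_mono)
    fix i assume i: "i \<in> {..s}"
    have "real (n choose i) * fact i \<le> real n ^ i"
      by (metis binomial_fact_pow of_nat_fact of_nat_le_iff of_nat_mult of_nat_power)
    then have "real (n choose i) \<le> real n ^ i / fact i"
      by (simp add: pos_le_divide_eq)
    then have "real (n choose i) * w ^ i \<le> (real n ^ i / fact i) * w ^ i"
      using assms by (intro mult_right_mono) auto
    also have "\<dots> = l ^ i * (z ^ i / fact i)"
      using assms by (simp add: z_def power_divide power_mult_distrib)
    also have "\<dots> \<le> l ^ s * (z ^ i / fact i)"
      using assms i z by (intro mult_right_mono power_increasing) auto
    finally show "real (n choose i) * w ^ i \<le> l ^ s * (z ^ i / fact i)" .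
  qed
  also have "\<dots> = l ^ s * (\<Sum>i\<le>s. z ^ i / fact i)"
    by (simp add: sum_distrib_left)
  also have "(\<Sum>i\<le>s. z ^ i / fact i) \<le> exp z"
  proof -
    have "(\<Sum>i\<in>{..s}. inverse (fact i) *\<^sub>R z ^ i) \<le> (\<Sum>i. inverse (fact i) *\<^sub>R z ^ i)"
      using z by (intro sum_le_suminf summable_exp_generic) auto
    then show ?thesis by (simp add: exp_def divide_inverse mult.commute)
  qed
  finally show ?thesis using assms by (simp add: z_def mult_left_mono)
qed

text \<open>
  Fixing \<open>i\<close> further elements of a \<open>t\<close>-set lowers the target size from \<open>t - j\<close> to \<open>t - (j + i)\<close> and
  gains a factor \<open>w ^ i\<close>; this factor pays for the choice of these elements, so that \<open>W\<close> grows only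
  by a factor \<open>weight_sum\<close> in a branching.
\<close>

definition count_le ::
    "nat \<Rightarrow> real \<Rightarrow> real \<Rightarrow> 'a set set \<Rightarrow> nat \<Rightarrow> real \<Rightarrow> bool" where
  "count_le t w B \<F> J W \<longleftrightarrow>
     (\<forall>j\<le>J. j \<le> t \<longrightarrow> real (card {X \<in> \<F>. card X = t - j}) \<le> W * w ^ j * B)"

lemma count_le_mono:
  assumes "count_le t w B \<F> J' W'" "J \<le> J'" "W' \<le> W" "0 \<le> w" "0 \<le> B"
  shows "count_le t w B \<F> J W"
  unfolding count_le_def
proof (intro allI impI)
  fix j assume j: "j \<le> J" "j \<le> t"
  have "real (card {X \<in> \<F>. card X = t - j}) \<le> W' * w ^ j * B"
    using assms(1,2) j unfolding count_le_def by auto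
  also have "\<dots> \<le> W * w ^ j * B"
    using assms by (intro mult_right_mono) auto
  finally show "real (card {X \<in> \<F>. card X = t - j}) \<le> W * w ^ j * B" .
qed

text \<open>\<open>X\<close> is recovered from the pair \<open>f\<close>, \<open>X - f\<close>, so a
  union bound over \<open>f\<close> applies. The rest \<open>X - f\<close> belongs to level
  \<open>j + card f\<close>, which is why the hypothesis must reach up to
  \<open>J + s\<close>.\<close>

lemma count_le_branch:
  assumes V: "finite V" and \<F>: "\<And>X. X \<in> \<F> \<Longrightarrow> X \<subseteq> V"
    and ex: "\<And>X. X \<in> \<F> \<Longrightarrow> \<exists>f\<subseteq>X. card f \<le> s \<and> X - f \<in> \<G> f"
    and \<G>: "\<And>f. \<G> f \<subseteq> Pow V"
    and le: "\<And>f. f \<subseteq> V \<Longrightarrow> card f \<le> s \<Longrightarrow> count_le t w B (\<G> f) (J + s) W"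
    and nonneg: "0 \<le> w" "0 \<le> B" "0 \<le> W"
  shows "count_le t w B \<F> J (weight_sum (card V) s w * W)"
  unfolding count_le_def
proof (intro allI impI)
  fix j assume j: "j \<le> J" "j \<le> t"
  define T where "T = {f. f \<subseteq> V \<and> card f \<le> s}"
  \<comment> \<open>Fingerprints larger than the target size are removed, since for them the
    truncated subtraction \<open>t - (j + card f)\<close> would no longer be the size of the
    rest.\<close>
  define T' where "T' = {f \<in> T. card f \<le> t - j}"
  define R where "R f = {Y \<in> \<G> f. card Y = t - (j + card f)}" for f
  have finT: "finite T" "finite T'" using V by (auto simp: T_def T'_def)
  have finR: "finite (R f)" for f
    using V \<G>[of f] by (auto simp: R_def intro: finite_subset[of _ "Pow V"])
  have "{X \<in> \<F>. card X = t - j} \<subseteq> (\<Union>f\<in>T'. (\<lambda>Y. f \<union> Y) ` R f)"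
  proof
    fix X assume X: "X \<in> {X \<in> \<F>. card X = t - j}"
    then obtain f where f: "f \<subseteq> X" "card f \<le> s" "X - f \<in> \<G> f" using ex by blast
    have finX: "finite X" using X \<F> V finite_subset by blast
    then have "card (X - f) = t - (j + card f)" "card f \<le> t - j"
      using X f(1) card_mono[OF finX f(1)] by (auto simp: card_Diff_subset finite_subset)
    then have "f \<in> T'" "X - f \<in> R f" "X = f \<union> (X - f)"
      using f X \<F>[of X] by (auto simp: T'_def T_def R_def)
    then show "X \<in> (\<Union>f\<in>T'. (\<lambda>Y. f \<union> Y) ` R f)" by blast
  qed
  then have "card {X \<in> \<F>. card X = t - j} \<le> card (\<Union>f\<in>T'. (\<lambda>Y. f \<union> Y) ` R f)"
    using finT finR by (intro card_mono) auto
  also have "\<dots> \<le> (\<Sum>f\<in>T'. card ((\<lambda>Y. f \<union> Y) ` R f))"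
    using finT(2) by (rule card_UN_le)
  also have "\<dots> \<le> (\<Sum>f\<in>T'. card (R f))"
    by (intro sum_mono card_image_le finR)
  finally have "real (card {X \<in> \<F>. card X = t - j}) \<le> (\<Sum>f\<in>T'. real (card (R f)))"
    by (metis of_nat_le_iff of_nat_sum)
  also have "\<dots> \<le> (\<Sum>f\<in>T'. W * w ^ (j + card f) * B)"
  proof (rule sum_mono)
    fix f assume "f \<in> T'"
    then show "real (card (R f)) \<le> W * w ^ (j + card f) * B"
      using le[of f] j unfolding count_le_def R_def T'_def T_def by auto
  qed
  also have "\<dots> \<le> (\<Sum>f\<in>T. W * w ^ (j + card f) * B)"
    using finT nonneg by (intro sum_mono2) (auto simp: T'_def)
  also have "\<dots> = W * w ^ j * B * (\<Sum>f\<in>T. w ^ card f)"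
    by (simp add: sum_distrib_left power_add mult_ac)
  also have "\<dots> = weight_sum (card V) s w * W * w ^ j * B"
    unfolding T_def sum_small_subsets[OF V] by (simp add: mult_ac)
  finally show "real (card {X \<in> \<F>. card X = t - j}) \<le> weight_sum (card V) s w * W * w ^ j * B" .
qed

section \<open>Fibres of maps and popular values\<close>

lemma card_fibers:
  assumes "finite Q" "finite F"
  shows "card {q \<in> Q. p q \<in> F} = (\<Sum>v\<in>F. card {q \<in> Q. p q = v})"
proof -
  have "{q \<in> Q. p q \<in> F} = (\<Union>v\<in>F. {q \<in> Q. p q = v})" by auto
  also have "card \<dots> = (\<Sum>v\<in>F. card {q \<in> Q. p q = v})"
    using assms by (intro card_UN_disjoint) auto
  finally show ?thesis .
qed

lemma card_fibers_ge:
  fixes c :: real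
  assumes "finite Q" "finite F" "\<And>v. v \<in> F \<Longrightarrow> c \<le> card {q \<in> Q. p q = v}"
  shows "card F * c \<le> card {q \<in> Q. p q \<in> F}"
  unfolding card_fibers[OF assms(1,2)] of_nat_sum
  using assms(3) by (rule sum_bounded_below)

lemma card_fibers_le:
  fixes c :: real
  assumes "finite Q" "finite F" "\<And>v. v \<in> F \<Longrightarrow> card {q \<in> Q. p q = v} \<le> c"
  shows "card {q \<in> Q. p q \<in> F} \<le> card F * c"
  unfolding card_fibers[OF assms(1,2)] of_nat_sum
  using assms(3) by (rule sum_bounded_above)

text \<open>Fibres over popular values have at most \<open>M\<close> elements, all others fewer than
  \<open>c\<close>. Read backwards: if \<open>Q\<close> is larger than \<open>card V * c\<close>,
  the excess divided by \<open>M\<close> bounds the number of popular values from below.\<close>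

lemma card_popular:
  fixes c M :: real
  assumes fin: "finite Q" "finite V" and Q: "\<And>q. q \<in> Q \<Longrightarrow> p q \<in> V"
    and M: "\<And>v. v \<in> V \<Longrightarrow> card {q \<in> Q. p q = v} \<le> M" and c: "0 \<le> c"
  shows "card Q \<le> card {v \<in> V. c \<le> card {q \<in> Q. p q = v}} * M + card V * c"
proof -
  define D where "D = {v \<in> V. c \<le> card {q \<in> Q. p q = v}}"
  have "Q = {q \<in> Q. p q \<in> D} \<union> {q \<in> Q. p q \<in> V - D}" using Q by (auto simp: D_def)
  then have "card Q \<le> card {q \<in> Q. p q \<in> D} + card {q \<in> Q. p q \<in> V - D}"
    by (metis card_Un_le)
  moreover have "card {q \<in> Q. p q \<in> D} \<le> card D * M"
    using fin M by (intro card_fibers_le) (auto simp: D_def)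
  moreover have "card {q \<in> Q. p q \<in> V - D} \<le> card (V - D) * c"
    using fin by (intro card_fibers_le) (auto simp: D_def)
  moreover have "card (V - D) * c \<le> card V * c"
    using fin c by (intro mult_right_mono) (auto intro: card_mono)
  ultimately show ?thesis unfolding D_def by linarith
qed

section \<open>Systems of parallelograms\<close>

lemma card_Sigma_le:
  fixes a b :: real
  assumes "finite A" "\<And>x. x \<in> A \<Longrightarrow> finite (B x)" "card A \<le> a"
    "\<And>x. x \<in> A \<Longrightarrow> card (B x) \<le> b" "0 \<le> b"
  shows "card (Sigma A B) \<le> a * b"
proof -
  have "real (card (Sigma A B)) = (\<Sum>x\<in>A. real (card (B x)))"
    using assms by (simp add: card_SigmaI)
  also have "\<dots> \<le> card A * b"
    using assms by (intro sum_bounded_above) auto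
  also have "\<dots> \<le> a * b"
    using assms by (intro mult_right_mono) auto
  finally show ?thesis .
qed

fun c1 c2 c3 c4 :: "'a \<times> 'a \<times> 'a \<times> 'a \<Rightarrow> 'a" where
  "c1 (x, z, y, w) = x"
| "c2 (x, z, y, w) = z"
| "c3 (x, z, y, w) = y"
| "c4 (x, z, y, w) = w"

text \<open>What may still be added inside the container \<open>A\<close>. \<open>F\<close> holds
  the picks of the current round; when a round ends, \<open>F\<close> is reset to \<open>{}\<close>
  and only the smaller container is kept.\<close>

definition completions :: "('a \<times> 'a \<times> 'a \<times> 'a) set \<Rightarrow> 'a set \<Rightarrow> 'a set \<Rightarrow> 'a set set" where
  "completions S A F = {Y. Y \<subseteq> A \<and> ((F \<union> Y) \<times> (F \<union> Y) \<times> (F \<union> Y) \<times> (F \<union> Y)) \<inter> S = {}}"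

text \<open>
  A quadruple \<open>(x, z, y, w) \<in> S\<close> is a parallelogram with rows \<open>x z\<close> and \<open>y w\<close> and columns
  \<open>x y\<close> and \<open>z w\<close>; \<open>\<rho> v\<close> and \<open>\<kappa> v\<close> are the row and the column of \<open>v\<close>.
\<close>

locale box_system =
  fixes V :: "'a set" and \<rho> \<kappa> :: "'a \<Rightarrow> 'a set"
    and S :: "('a \<times> 'a \<times> 'a \<times> 'a) set" and h k :: nat
  assumes finite_V: "finite V" and V_nonempty: "V \<noteq> {}"
    and S_subset: "S \<subseteq> V \<times> V \<times> V \<times> V"
    and \<rho>_subset: "u \<in> V \<Longrightarrow> \<rho> u \<subseteq> V" and \<kappa>_subset: "u \<in> V \<Longrightarrow> \<kappa> u \<subseteq> V"
    and \<rho>_refl: "u \<in> V \<Longrightarrow> u \<in> \<rho> u" and \<kappa>_refl: "u \<in> V \<Longrightarrow> u \<in> \<kappa> u"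
    and \<rho>_eq: "u \<in> V \<Longrightarrow> v \<in> \<rho> u \<Longrightarrow> \<rho> v = \<rho> u"
    and \<kappa>_eq: "u \<in> V \<Longrightarrow> v \<in> \<kappa> u \<Longrightarrow> \<kappa> v = \<kappa> u"
    and card_\<rho>: "u \<in> V \<Longrightarrow> card (\<rho> u) \<le> h" and card_\<kappa>: "u \<in> V \<Longrightarrow> card (\<kappa> u) \<le> k"
    and S_\<rho>: "(x, z, y, w) \<in> S \<Longrightarrow> z \<in> \<rho> x \<and> w \<in> \<rho> y"
    and S_\<kappa>: "(x, z, y, w) \<in> S \<Longrightarrow> y \<in> \<kappa> x \<and> w \<in> \<kappa> z"
    and det1: "(x, z, y, w) \<in> S \<Longrightarrow> (x', z, y, w) \<in> S \<Longrightarrow> x' = x"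
    and det2: "(x, z, y, w) \<in> S \<Longrightarrow> (x, z', y, w) \<in> S \<Longrightarrow> z' = z"
    and det3: "(x, z, y, w) \<in> S \<Longrightarrow> (x, z, y', w) \<in> S \<Longrightarrow> y' = y"
    and det4: "(x, z, y, w) \<in> S \<Longrightarrow> (x, z, y, w') \<in> S \<Longrightarrow> w' = w"
    and S_compose: "(x, z, y, w) \<in> S \<Longrightarrow> (x', z', y, w) \<in> S \<Longrightarrow>
      x' = x \<or> x' = z \<or> z' = x \<or> (x, z, x', z') \<in> S"
begin

lemma finite_S: "finite S"
  using S_subset finite_V by (meson finite_SigmaI finite_subset)

lemma finite_\<rho>: "u \<in> V \<Longrightarrow> finite (\<rho> u)" and finite_\<kappa>: "u \<in> V \<Longrightarrow> finite (\<kappa> u)"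
  by (rule finite_subset[OF \<rho>_subset finite_V], assumption)
    (rule finite_subset[OF \<kappa>_subset finite_V], assumption)

lemma \<rho>_sym: "u \<in> V \<Longrightarrow> v \<in> \<rho> u \<Longrightarrow> u \<in> \<rho> v" and \<kappa>_sym: "u \<in> V \<Longrightarrow> v \<in> \<kappa> u \<Longrightarrow> u \<in> \<kappa> v"
  using \<rho>_refl[of u] \<kappa>_refl[of u] \<rho>_eq[of u v] \<kappa>_eq[of u v] by simp_all

lemma S_in_V: "(x, z, y, w) \<in> S \<Longrightarrow> x \<in> V \<and> z \<in> V \<and> y \<in> V \<and> w \<in> V"
  using S_subset by auto

section \<open>How many parallelograms share a given vertex\<close>

lemma card_fiber1:
  assumes "Q \<subseteq> S" "x \<in> V"
  shows "real (card {q \<in> Q. c1 q = x}) \<le> real h * real k"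
proof -
  let ?F = "{q \<in> Q. c1 q = x}" and ?g = "\<lambda>q. (c2 q, c3 q)"
  have fin: "finite (Sigma (\<rho> x) (\<lambda>_. \<kappa> x))" using assms finite_\<rho> finite_\<kappa> by blast
  have "inj_on ?g ?F" by (auto simp: inj_on_def intro: det4 dest!: subsetD[OF assms(1)])
  moreover have "?g ` ?F \<subseteq> Sigma (\<rho> x) (\<lambda>_. \<kappa> x)" using assms S_\<rho> S_\<kappa> by fastforce
  ultimately have "card ?F \<le> card (Sigma (\<rho> x) (\<lambda>_. \<kappa> x))"
    using fin by (rule card_inj_on_le)
  moreover have "real (card (Sigma (\<rho> x) (\<lambda>_. \<kappa> x))) \<le> real h * real k"
    using assms by (intro card_Sigma_le) (auto simp: finite_\<rho> finite_\<kappa> card_\<rho> card_\<kappa>)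
  ultimately show ?thesis by linarith
qed

text \<open>With \<open>z\<close> fixed, \<open>x\<close> and \<open>y\<close> determine the
  quadruple. Now \<open>x\<close> ranges only over the picked points in the row of \<open>z\<close>,
  so the factor \<open>h\<close> is replaced by \<open>a\<close>.\<close>

lemma card_fiber2:
  fixes a :: real
  assumes "Q \<subseteq> S" "z \<in> V" "f \<subseteq> V" "c1 ` Q \<subseteq> f" "card (f \<inter> \<rho> z) \<le> a"
  shows "card {q \<in> Q. c2 q = z} \<le> a * real k"
proof -
  let ?F = "{q \<in> Q. c2 q = z}" and ?g = "\<lambda>q. (c1 q, c3 q)"
  let ?B = "Sigma (f \<inter> \<rho> z) \<kappa>"
  have fin: "finite ?B" using assms finite_\<rho> finite_\<kappa> by blast
  have "inj_on ?g ?F" by (auto simp: inj_on_def intro: det4 dest!: subsetD[OF assms(1)])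
  moreover have "?g ` ?F \<subseteq> ?B"
  proof clarsimp
    fix x y w assume "(x, z, y, w) \<in> Q"
    then show "x \<in> f \<and> x \<in> \<rho> z \<and> y \<in> \<kappa> x"
      using assms S_\<rho>[of x z y w] S_\<kappa>[of x z y w] S_in_V[of x z y w] \<rho>_sym[of x z]
      by (force simp: image_subset_iff)
  qed
  ultimately have "card ?F \<le> card ?B"
    using fin by (rule card_inj_on_le)
  moreover have "real (card ?B) \<le> a * real k"
    using assms by (intro card_Sigma_le) (auto simp: finite_\<rho> finite_\<kappa> card_\<kappa>)
  ultimately show ?thesis by linarith
qed

text \<open>With \<open>y\<close> fixed, the quadruple is determined by a picked \<open>x\<close> in
  the column of \<open>y\<close> and a picked \<open>z\<close> in the row of \<open>x\<close>. For
  capped picks this bound and the one for a fixed \<open>w\<close> are the same product of a column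
  cap and a row cap.\<close>

lemma card_fiber3:
  fixes a b :: real
  assumes "Q \<subseteq> S" "y \<in> V" "f \<subseteq> V" "g \<subseteq> V" "c1 ` Q \<subseteq> f" "c2 ` Q \<subseteq> g"
    "card (f \<inter> \<kappa> y) \<le> b" "\<And>x. x \<in> V \<Longrightarrow> card (g \<inter> \<rho> x) \<le> a"
  shows "card {q \<in> Q. c3 q = y} \<le> b * a"
proof -
  let ?F = "{q \<in> Q. c3 q = y}" and ?g = "\<lambda>q. (c1 q, c2 q)"
  let ?B = "Sigma (f \<inter> \<kappa> y) (\<lambda>x. g \<inter> \<rho> x)"
  have finf: "finite f" and fing: "finite g" using assms(3,4) finite_V finite_subset by blast+
  then have fin: "finite ?B" by (intro finite_SigmaI) auto
  have "inj_on ?g ?F" by (auto simp: inj_on_def intro: det4 dest!: subsetD[OF assms(1)])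
  moreover have "?g ` ?F \<subseteq> ?B"
  proof clarsimp
    fix x z w assume "(x, z, y, w) \<in> Q"
    then show "x \<in> f \<and> x \<in> \<kappa> y \<and> z \<in> g \<and> z \<in> \<rho> x"
      using assms(1-6) S_\<rho>[of x z y w] S_\<kappa>[of x z y w] S_in_V[of x z y w] \<kappa>_sym[of x y]
      by (force simp: image_subset_iff)
  qed
  ultimately have "card ?F \<le> card ?B"
    using fin by (rule card_inj_on_le)
  moreover have "real (card ?B) \<le> b * a"
  proof (rule card_Sigma_le)
    show "0 \<le> a" using assms(8)[OF assms(2)] by linarith
  qed (use assms(3,4,7,8) finf fing in auto)
  ultimately show ?thesis by linarith
qed

lemma card_fiber4:
  fixes a b :: real
  assumes "Q \<subseteq> S" "w \<in> V" "f \<subseteq> V" "g \<subseteq> V" "c1 ` Q \<subseteq> f" "c2 ` Q \<subseteq> g"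
    "card (g \<inter> \<kappa> w) \<le> b" "\<And>x. x \<in> V \<Longrightarrow> card (f \<inter> \<rho> x) \<le> a"
  shows "card {q \<in> Q. c4 q = w} \<le> b * a"
proof -
  let ?F = "{q \<in> Q. c4 q = w}" and ?g = "\<lambda>q. (c2 q, c1 q)"
  let ?B = "Sigma (g \<inter> \<kappa> w) (\<lambda>x. f \<inter> \<rho> x)"
  have finf: "finite f" and fing: "finite g" using assms(3,4) finite_V finite_subset by blast+
  then have fin: "finite ?B" by (intro finite_SigmaI) auto
  have "inj_on ?g ?F" by (auto simp: inj_on_def intro: det3 dest!: subsetD[OF assms(1)])
  moreover have "?g ` ?F \<subseteq> ?B"
  proof clarsimp
    fix x z y assume "(x, z, y, w) \<in> Q"
    then show "z \<in> g \<and> z \<in> \<kappa> w \<and> x \<in> f \<and> x \<in> \<rho> z"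
      using assms(1-6) S_\<rho>[of x z y w] S_\<kappa>[of x z y w] S_in_V[of x z y w] \<kappa>_sym[of z w] \<rho>_sym[of x z]
      by (force simp: image_subset_iff)
  qed
  ultimately have "card ?F \<le> card ?B"
    using fin by (rule card_inj_on_le)
  moreover have "real (card ?B) \<le> b * a"
  proof (rule card_Sigma_le)
    show "0 \<le> a" using assms(8)[OF assms(2)] by linarith
  qed (use assms(3,4,7,8) finf fing in auto)
  ultimately show ?thesis by linarith
qed

text \<open>Two quadruples with the same last two vertices compose, by \<open>S_compose\<close>, to
  a parallelogram on their four remaining vertices, which all lie in the \<open>S\<close>-free set
  \<open>F\<close>. So, against a fixed quadruple, only the three degenerate cases of
  \<open>S_compose\<close> remain, and by \<open>det1\<close> and \<open>det2\<close> each admits at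
  most one quadruple.\<close>

lemma card_fiber34:
  assumes Q: "Q \<subseteq> S" "c1 ` Q \<subseteq> F" "c2 ` Q \<subseteq> F" and F: "(F \<times> F \<times> F \<times> F) \<inter> S = {}"
  shows "card {q \<in> Q. c3 q = y \<and> c4 q = w} \<le> 3"
proof (cases "{q \<in> Q. c3 q = y \<and> c4 q = w} = {}")
  case False
  let ?M = "{q \<in> Q. c3 q = y \<and> c4 q = w}"
  obtain x z where xz: "(x, z, y, w) \<in> Q" using False by fastforce
  have fin: "finite ?M" using Q(1) finite_S finite_subset by fastforce
  have fin': "finite {q \<in> ?M. c1 q = v}" "finite {q \<in> ?M. c2 q = v}" for v
    by (rule finite_subset[OF _ fin], blast)+
  have one: "card {q \<in> ?M. c1 q = v} \<le> Suc 0" "card {q \<in> ?M. c2 q = v} \<le> Suc 0" for v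
    using fin'[of v]
    by (auto simp: card_le_Suc0_iff_eq dest!: subsetD[OF Q(1)] intro: det1 det2)
  have "?M \<subseteq> {q \<in> ?M. c1 q = x} \<union> {q \<in> ?M. c1 q = z} \<union> {q \<in> ?M. c2 q = x}"
  proof
    fix q assume q: "q \<in> ?M"
    obtain x' z' where q': "q = (x', z', y, w)" using q by (cases q) auto
    have "x \<in> F" "z \<in> F" "x' \<in> F" "z' \<in> F" using Q xz q q' by force+
    then have "(x, z, x', z') \<notin> S" using F by blast
    then show "q \<in> {q \<in> ?M. c1 q = x} \<union> {q \<in> ?M. c1 q = z} \<union> {q \<in> ?M. c2 q = x}"
      using S_compose[OF subsetD[OF Q(1) xz], of x' z'] subsetD[OF Q(1)] q q' by auto
  qed
  then have "card ?M \<le> card ({q \<in> ?M. c1 q = x} \<union> {q \<in> ?M. c1 q = z} \<union> {q \<in> ?M. c2 q = x})"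
    by (rule card_mono[rotated]) (intro finite_UnI fin')
  also have "\<dots> \<le> card {q \<in> ?M. c1 q = x} + card {q \<in> ?M. c1 q = z} + card {q \<in> ?M. c2 q = x}"
    by (meson add_le_mono card_Un_le le_refl order_trans)
  also have "\<dots> \<le> 3" using one(1)[of x] one(1)[of z] one(2)[of x] by linarith
  finally show ?thesis .
qed (metis card.empty le0)

section \<open>Picks that meet every row and column in few points\<close>

definition capped :: "real \<Rightarrow> nat \<Rightarrow> 'a set \<Rightarrow> bool" where
  "capped L s f \<longleftrightarrow> (\<forall>u\<in>V.
    card (f \<inter> \<rho> u) \<le> L * real s * real h / real (card V) \<and>
    card (f \<inter> \<kappa> u) \<le> L * real s * real k / real (card V))"

text \<open>A random \<open>s\<close>-subset of \<open>V\<close> meets a row of \<open>h\<close>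
  elements in \<open>s * h / card V\<close> points on average, so \<open>L\<close> is the permitted
  excess over the average in \<open>capped\<close>. The full vertices are those whose addition to
  \<open>f\<close> may break a cap.\<close>

definition full :: "real \<Rightarrow> nat \<Rightarrow> 'a set \<Rightarrow> 'a set" where
  "full L s f = {u \<in> V.
    L * real s * real h / real (card V) < card (f \<inter> \<rho> u) + 1 \<or>
    L * real s * real k / real (card V) < card (f \<inter> \<kappa> u) + 1}"

lemma card_V_pos: "0 < card V"
  using finite_V V_nonempty by (simp add: card_gt_0_iff)

text \<open>Take \<open>f\<close> inclusion-maximal among the capped subsets of \<open>X\<close> of
  size at most \<open>s\<close>. If it stops short of \<open>s\<close>, no remaining element can be
  added without breaking a cap, so all of them are full.\<close>

lemma capped_pick:
  assumes X: "X \<subseteq> V" and L: "0 \<le> L"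
  obtains f where "f \<subseteq> X" "card f \<le> s" "capped L s f" "card f = s \<or> X - f \<subseteq> full L s f"
proof -
  define T where "T = {f. f \<subseteq> X \<and> card f \<le> s \<and> capped L s f}"
  have finX: "finite X" using X finite_V finite_subset by blast
  have "finite T" by (rule finite_subset[of _ "Pow X"]) (use finX in \<open>auto simp: T_def\<close>)
  moreover have "{} \<in> T" using L by (auto simp: T_def capped_def)
  ultimately obtain f where f: "f \<in> T" and max: "\<And>g. g \<in> T \<Longrightarrow> f \<subseteq> g \<Longrightarrow> f = g"
    using finite_has_maximal[of T] by blast
  have finf: "finite f" using f finX finite_subset by (auto simp: T_def)
  have "card f = s \<or> X - f \<subseteq> full L s f"
  proof (rule ccontr)
    assume "\<not> ?thesis"
    then obtain x where x: "x \<in> X" "x \<notin> f" "x \<notin> full L s f" and ne: "card f \<noteq> s" by blast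
    have xV: "x \<in> V" using x X by blast
    have "capped L s (insert x f)"
      unfolding capped_def
    proof (intro ballI conjI)
      fix u assume u: "u \<in> V"
      show "card (insert x f \<inter> \<rho> u) \<le> L * real s * real h / real (card V)"
      proof (cases "x \<in> \<rho> u")
        case True
        then have "\<rho> x = \<rho> u" using \<rho>_eq u by blast
        then have "insert x f \<inter> \<rho> u = insert x (f \<inter> \<rho> x)" using True by blast
        then have "card (insert x f \<inter> \<rho> u) \<le> card (f \<inter> \<rho> x) + 1"
          using finf x by simp
        then show ?thesis using x xV by (auto simp: full_def not_less)
      next
        case False
        then show ?thesis using f u by (auto simp: T_def capped_def)
      qed
      show "card (insert x f \<inter> \<kappa> u) \<le> L * real s * real k / real (card V)"
      proof (cases "x \<in> \<kappa> u")
        case True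
        then have "\<kappa> x = \<kappa> u" using \<kappa>_eq u by blast
        then have "insert x f \<inter> \<kappa> u = insert x (f \<inter> \<kappa> x)" using True by blast
        then have "card (insert x f \<inter> \<kappa> u) \<le> card (f \<inter> \<kappa> x) + 1"
          using finf x by simp
        then show ?thesis using x xV by (auto simp: full_def not_less)
      next
        case False
        then show ?thesis using f u by (auto simp: T_def capped_def)
      qed
    qed
    then have "insert x f \<in> T" using f x ne finf by (auto simp: T_def)
    then show False using max[of "insert x f"] x by blast
  qed
  then show ?thesis using that f by (auto simp: T_def)
qed

text \<open>Double counting of the pairs \<open>u\<close>, \<open>v\<close> with
  \<open>v \<in> f \<inter> \<sigma> u\<close>: by symmetry there are at most \<open>s * r\<close>
  of them, and each heavy \<open>u\<close> lies in at least \<open>(L - 1) * s * r / card V\<close>.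
  The assumption \<open>card V \<le> s * r\<close> makes the average at least 1, which absorbs the
  \<open>+ 1\<close>.\<close>

lemma card_heavy:
  fixes r :: nat and \<sigma> :: "'a \<Rightarrow> 'a set"
  assumes f: "f \<subseteq> V" "card f \<le> s" and \<sigma>: "\<And>u. u \<in> V \<Longrightarrow> card (\<sigma> u) \<le> r" "\<And>u. u \<in> V \<Longrightarrow> \<sigma> u \<subseteq> V"
    "\<And>u v. u \<in> V \<Longrightarrow> v \<in> \<sigma> u \<Longrightarrow> u \<in> \<sigma> v"
    and s: "card V \<le> s * r"
  shows "(L - 1) * card {u \<in> V. L * real s * real r / real (card V) < card (f \<inter> \<sigma> u) + 1} \<le> card V"
proof -
  let ?F = "{u \<in> V. L * real s * real r / real (card V) < card (f \<inter> \<sigma> u) + 1}"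
  define n where "n = real (card V)"
  have n: "0 < n" using card_V_pos by (simp add: n_def)
  have sr: "n \<le> s * r" using s by (simp add: n_def of_nat_mult[symmetric] del: of_nat_mult)
  have finf: "finite f" using f finite_V finite_subset by blast
  have fin\<sigma>: "finite (\<sigma> u)" if "u \<in> V" for u using \<sigma>(2) that finite_V finite_subset by blast
  have "card ?F * ((L - 1) * s * r / n) \<le> (\<Sum>u\<in>?F. real (card (f \<inter> \<sigma> u)))"
  proof (rule sum_bounded_below)
    fix u assume "u \<in> ?F"
    then have "L * s * r / n < card (f \<inter> \<sigma> u) + 1" by (simp add: n_def)
    moreover have "1 \<le> s * r / n" using sr n by simp
    moreover have "(L - 1) * s * r / n = L * s * r / n - s * r / n" 
      by (simp add: left_diff_distrib diff_divide_distrib)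
    ultimately show "(L - 1) * s * r / n \<le> card (f \<inter> \<sigma> u)" by linarith
  qed
  also have "\<dots> \<le> (\<Sum>u\<in>V. real (card (f \<inter> \<sigma> u)))"
    using finite_V by (intro sum_mono2) auto
  also have "\<dots> = (\<Sum>u\<in>V. \<Sum>v\<in>f. of_bool (v \<in> \<sigma> u))"
    using finf by (intro sum.cong[OF refl]) (simp add: Int_def)
  also have "\<dots> = (\<Sum>v\<in>f. \<Sum>u\<in>V. of_bool (v \<in> \<sigma> u))"
    by (rule sum.swap)
  also have "\<dots> \<le> (\<Sum>v\<in>f. real r)"
  proof (rule sum_mono)
    fix v assume "v \<in> f"
    then have v: "v \<in> V" using f by blast
    have "(\<Sum>u\<in>V. of_bool (v \<in> \<sigma> u)) = real (card {u \<in> V. v \<in> \<sigma> u})"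
      using finite_V by (simp add: Int_def)
    also have "card {u \<in> V. v \<in> \<sigma> u} \<le> card (\<sigma> v)"
      using v \<sigma> fin\<sigma> by (intro card_mono) auto
    finally show "(\<Sum>u\<in>V. of_bool (v \<in> \<sigma> u)) \<le> real r" using \<sigma>(1)[OF v] by linarith
  qed
  also have "\<dots> \<le> s * r" using f by (simp add: mult_right_mono)
  finally have "card ?F * ((L - 1) * s * r / n) * n \<le> s * r * n"
    using n by (intro mult_right_mono) auto
  then have "(s * r) * ((L - 1) * card ?F) \<le> (s * r) * n" using n by (simp add: mult_ac)
  moreover have "0 < real (s * r)" using sr n by linarith
  ultimately show ?thesis unfolding n_def by (meson mult_le_cancel_left_pos)
qed

lemma card_full:
  assumes f: "f \<subseteq> V" "card f \<le> s" and "card V \<le> s * h" "card V \<le> s * k" "1 \<le> L"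
  shows "(L - 1) * card (full L s f) \<le> 2 * card V"
proof -
  let ?F = "{u \<in> V. L * real s * real h / real (card V) < card (f \<inter> \<rho> u) + 1}"
  let ?G = "{u \<in> V. L * real s * real k / real (card V) < card (f \<inter> \<kappa> u) + 1}"
  have "full L s f = ?F \<union> ?G" by (auto simp: full_def)
  then have "card (full L s f) \<le> card ?F + card ?G" by (simp add: card_Un_le)
  then have "(L - 1) * card (full L s f) \<le> (L - 1) * (real (card ?F) + real (card ?G))"
    using assms(5) by (intro mult_left_mono) auto
  moreover have "(L - 1) * card ?F \<le> card V"
    by (rule card_heavy[OF f card_\<rho> \<rho>_subset \<rho>_sym assms(3)])
  moreover have "(L - 1) * card ?G \<le> card V"
    by (rule card_heavy[OF f card_\<kappa> \<kappa>_subset \<kappa>_sym assms(4)])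
  ultimately show ?thesis by (simp add: distrib_left)
qed

end

lemma completions_mono:
  assumes "X \<in> completions S A F" "F' \<union> Y \<subseteq> F \<union> X" "Y \<subseteq> A'"
  shows "Y \<in> completions S A' F'"
proof -
  have "(F' \<union> Y) \<times> (F' \<union> Y) \<times> (F' \<union> Y) \<times> (F' \<union> Y) \<subseteq> (F \<union> X) \<times> (F \<union> X) \<times> (F \<union> X) \<times> (F \<union> X)"
    using assms(2) by (intro Sigma_mono) auto
  then show ?thesis using assms unfolding completions_def by blast
qed

section \<open>The third pick\<close>

context box_system
begin

text \<open>\<open>f1\<close> and \<open>f2\<close> are the first two picks, and \<open>Q\<close>
  consists of parallelograms in \<open>A\<close> that start with them. The excluded set
  \<open>B f\<close> depends on \<open>f\<close> alone: it is the set \<open>U f\<close> of fourth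
  vertices reached from \<open>f\<close> if this is large, and otherwise the set \<open>D f\<close>
  of third vertices that would each reach many new ones. The rest avoids \<open>U f\<close> because
  it is \<open>S\<close>-free, and \<open>D f\<close> because \<open>f\<close> is maximal.\<close>

lemma third_choice:
  fixes \<eta> L n :: real
  defines "n \<equiv> real (card V)"
  assumes A: "A \<subseteq> V" and f12: "f1 \<subseteq> V" "f2 \<subseteq> V" "capped L s f1" "capped L s f2"
    and Q: "Q \<subseteq> S \<inter> (A \<times> A \<times> A \<times> A)" "c1 ` Q \<subseteq> f1" "c2 ` Q \<subseteq> f2"
    and Q_large: "\<eta> / 4 * (s ^ 2 * h * k / n) \<le> card Q"
    and \<eta>: "0 < \<eta>" and L: "1 \<le> L"
    and pos: "0 < s" "0 < h" "0 < k" and large: "n ^ 3 \<le> s ^ 3 * h * k" and s': "48 * s \<le> \<eta> * s'"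
  obtains B where "\<And>f. B f \<subseteq> A" "\<And>f. \<eta> / (16 * L\<^sup>2) * n \<le> card (B f)"
    "\<And>Y. Y \<in> completions S A (f1 \<union> f2) \<Longrightarrow>
      \<exists>f\<subseteq>Y. card f \<le> s' \<and> Y - f \<in> completions S (A - B f) {}"
proof -
  define E where "E = real s ^ 2 * h * k / n"
  \<comment> \<open>\<open>E\<close> is the scale of \<open>card Q\<close>, \<open>M\<close> the
    fibre bound for capped picks, and \<open>g\<close> the required number of new fourth vertices
    per element of \<open>f\<close>. The 48 is 3 * 16: the 3 comes from \<open>card_fiber34\<close>,
    and the unpopular vertices lose \<open>n * (3 * g) = \<eta> / 16 * E\<close>, half of what is
    left after the quadruples ending in \<open>U f\<close> are discarded.\<close>
  define g where "g = \<eta> / 48 * (E / n)"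
  define M where "M = L\<^sup>2 * E / n"
  define U where "U f = c4 ` {q \<in> Q. c3 q \<in> f}" for f
  define D where "D f = {y \<in> A. 3 * g \<le> card {q \<in> {q \<in> Q. c4 q \<notin> U f}. c3 q = y}}" for f
  define B where "B f = (if \<eta> / (8 * L\<^sup>2) * n \<le> card (U f) then U f else D f)" for f
  have n: "0 < n" using card_V_pos by (simp add: n_def)
  have E: "0 < E" using n pos by (simp add: E_def)
  have g: "0 < g" using n E \<eta> by (simp add: g_def)
  have M: "0 < M" using n E L by (simp add: M_def)
  have finQ: "finite Q" using Q(1) finite_S finite_subset by blast
  have finA: "finite A" using A finite_V finite_subset by blast
  have U_A: "U f \<subseteq> A" for f using Q(1) by (force simp: U_def)
  have finU: "finite (U f)" for f using U_A finA finite_subset by blast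
  have D_A: "D f \<subseteq> A" for f by (auto simp: D_def)
  have cardA: "card A \<le> n" using A finite_V by (simp add: n_def card_mono)
  have M_eq: "L * real s * real k / real (card V) * (L * real s * real h / real (card V)) = M"
    by (simp add: M_def E_def n_def power2_eq_square)
  have D_large: "\<eta> / (16 * L\<^sup>2) * n \<le> card (D f)" if small: "\<not> \<eta> / (8 * L\<^sup>2) * n \<le> card (U f)" for f
  proof -
    let ?Q' = "{q \<in> Q. c4 q \<notin> U f}"
    have "card {q \<in> Q. c4 q \<in> U f} \<le> card (U f) * M"
    proof (rule card_fibers_le[OF finQ finU])
      fix w assume "w \<in> U f"
      then have w: "w \<in> V" using U_A A by blast
      show "card {q \<in> Q. c4 q = w} \<le> M"
        unfolding M_eq[symmetric]
        by (rule card_fiber4[OF _ w f12(1,2) Q(2,3)]) (use f12 Q w in \<open>auto simp: capped_def\<close>)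
    qed
    also have "\<dots> \<le> (\<eta> / (8 * L\<^sup>2) * n) * M"
      using small M by (intro mult_right_mono) auto
    also have "\<dots> = \<eta> / 8 * E"
      using L n by (simp add: M_def field_simps)
    finally have 1: "card {q \<in> Q. c4 q \<in> U f} \<le> \<eta> / 8 * E" .
    have "card Q = card (?Q' \<union> {q \<in> Q. c4 q \<in> U f})"
      by (rule arg_cong[where f = card]) auto
    also have "\<dots> \<le> card ?Q' + card {q \<in> Q. c4 q \<in> U f}" by (rule card_Un_le)
    finally have "\<eta> / 8 * E \<le> card ?Q'" using 1 Q_large by (simp add: E_def)
    also have "card ?Q' \<le> card (D f) * M + card A * (3 * g)"
      unfolding D_def
    proof (rule card_popular)
      fix y assume "y \<in> A"
      then have y: "y \<in> V" using A by blast
      show "card {q \<in> ?Q'. c3 q = y} \<le> M"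
        unfolding M_eq[symmetric]
        by (rule card_fiber3[OF _ y f12(1,2)]) (use f12 Q y in \<open>auto simp: capped_def\<close>)
    qed (use finQ finA g Q(1) in auto)
    also have "card A * (3 * g) \<le> n * (3 * g)" using cardA g by (intro mult_right_mono) auto
    also have "n * (3 * g) = \<eta> / 16 * E" using n by (simp add: g_def)
    finally have "\<eta> / 16 * E \<le> card (D f) * M" by linarith
    moreover have "\<eta> / 16 * E = (\<eta> / (16 * L\<^sup>2) * n) * M" using L n by (simp add: M_def field_simps)
    ultimately show ?thesis using M by (metis mult_le_cancel_right_pos)
  qed
  have *: "\<exists>f\<subseteq>Y. card f \<le> s' \<and> Y - f \<in> completions S (A - B f) {}"
    if Y: "Y \<in> completions S A (f1 \<union> f2)" for Y
  proof -
    txt \<open>A maximal member of \<open>T\<close> replaces a greedy choice of vertices with many new neighbours.\<close>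
    define T where "T = {f. f \<subseteq> Y \<and> card f * g \<le> card (U f)}"
    have YA: "Y \<subseteq> A" using Y by (simp add: completions_def)
    have free: "(x, z, y, w) \<notin> S" if "x \<in> f1" "z \<in> f2" "y \<in> Y" "w \<in> Y" for x z y w
      using Y that by (auto simp: completions_def)
    have free12: "((f1 \<union> f2) \<times> (f1 \<union> f2) \<times> (f1 \<union> f2) \<times> (f1 \<union> f2)) \<inter> S = {}"
      using Y by (auto simp: completions_def)
    have "finite T" by (rule finite_subset[of _ "Pow Y"])
      (use finite_subset[OF YA finA] in \<open>auto simp: T_def\<close>)
    moreover have "{} \<in> T" by (simp add: T_def)
    ultimately obtain f where f: "f \<in> T" and max: "\<And>g. g \<in> T \<Longrightarrow> f \<subseteq> g \<Longrightarrow> f = g"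
      using finite_has_maximal[of T] by blast
    have fY: "f \<subseteq> Y" using f by (simp add: T_def)
    have finf: "finite f" using fY YA finA by (meson finite_subset)
    have "card (U f) \<le> card A" using U_A finA by (rule card_mono[rotated])
    then have "card f * g \<le> n" using f cardA by (simp add: T_def)
    \<comment> \<open>Here the size of \<open>s\<close> matters: \<open>n / g\<close> equals
      \<open>48 * n ^ 3 / (\<eta> * s ^ 2 * h * k)\<close>, which is at most
      \<open>48 * s / \<eta>\<close> and hence at most \<open>s'\<close>.\<close>
    then have "card f * (\<eta> * (real s ^ 2 * h * k)) \<le> 48 * n ^ 3"
      using n by (simp add: g_def E_def field_simps power3_eq_cube)
    also have "\<dots> \<le> 48 * (s ^ 3 * h * k)" using large by simp
    also have "\<dots> = 48 * s * (real s ^ 2 * h * k)" by (simp add: power3_eq_cube power2_eq_square)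
    also have "\<dots> \<le> \<eta> * s' * (real s ^ 2 * h * k)" using s' by (intro mult_right_mono) auto
    finally have "card f * (\<eta> * (real s ^ 2 * h * k)) \<le> s' * (\<eta> * (real s ^ 2 * h * k))"
      by (simp add: mult_ac)
    then have "card f \<le> s'" using \<eta> pos by (simp add: mult_le_cancel_right_pos)
    moreover have "(Y - f) \<inter> B f = {}"
    proof (cases "\<eta> / (8 * L\<^sup>2) * n \<le> card (U f)")
      case True
      have "w \<notin> Y" if "w \<in> U f" for w :: 'a
      proof -
        obtain q where q: "q \<in> Q" "c3 q \<in> f" "w = c4 q" using \<open>w \<in> U f\<close> unfolding U_def by blast
        obtain x z y where q': "q = (x, z, y, w)" using q by (cases q) auto
        have "x \<in> f1" "z \<in> f2" "y \<in> Y" "q \<in> S" using q q' Q fY by force+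
        then show ?thesis using free q' by blast
      qed
      then show ?thesis using True by (auto simp: B_def)
    next
      case False
      have "y \<notin> D f" if y: "y \<in> Y - f" for y
      proof
        assume yD: "y \<in> D f"
        let ?P = "{q \<in> {q \<in> Q. c4 q \<notin> U f}. c3 q = y}"
        have finP: "finite ?P" using finQ by simp
        \<comment> \<open>Each fourth vertex accounts for at most three quadruples over
          \<open>y\<close>, so \<open>3 * g\<close> quadruples yield at least \<open>g\<close> new
          fourth vertices, and \<open>insert y f\<close> would contradict maximality.\<close>
        have "card {q \<in> ?P. c4 q \<in> c4 ` ?P} \<le> card (c4 ` ?P) * (3::real)"
        proof (rule card_fibers_le[OF finP])
          fix w
          have "card {q \<in> ?P. c4 q = w} \<le> card {q \<in> Q. c3 q = y \<and> c4 q = w}"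
            using finQ by (intro card_mono) auto
          also have "\<dots> \<le> 3"
            by (rule card_fiber34[OF _ _ _ free12]) (use Q in auto)
          finally show "real (card {q \<in> ?P. c4 q = w}) \<le> 3" by simp
        qed (use finP in simp)
        also have "{q \<in> ?P. c4 q \<in> c4 ` ?P} = ?P" by auto
        finally have new: "g \<le> card (c4 ` ?P)" using yD by (simp add: D_def)
        have "U f \<union> c4 ` ?P \<subseteq> U (insert y f)" by (auto simp: U_def)
        then have "card (U f \<union> c4 ` ?P) \<le> card (U (insert y f))" using finU by (rule card_mono[rotated])
        moreover have "card (U f \<union> c4 ` ?P) = card (U f) + card (c4 ` ?P)"
          using finU finP by (intro card_Un_disjoint) auto
        ultimately have "card (U f) + g \<le> card (U (insert y f))" using new by linarith
        moreover have "card (insert y f) * g = card f * g + g"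
          using finf y by (simp add: distrib_right)
        ultimately have "insert y f \<in> T" using f y by (auto simp: T_def)
        then show False using max[of "insert y f"] y by blast
      qed
      then show ?thesis using False by (auto simp: B_def)
    qed
    ultimately show ?thesis
      using fY YA by (intro exI[of _ f] conjI completions_mono[OF Y]) auto
  qed
  show ?thesis
  proof (rule that[of B])
    show "B f \<subseteq> A" for f using U_A D_A by (simp add: B_def)
    have "\<eta> / (16 * L\<^sup>2) * n \<le> \<eta> / (8 * L\<^sup>2) * n"
      using \<eta> L n by (intro mult_right_mono divide_left_mono) auto
    then show "\<eta> / (16 * L\<^sup>2) * n \<le> card (B f)" for f
      using D_large[of f] by (auto simp: B_def)
  qed (fact *)
qed

end

section \<open>One round of three picks\<close>

lemma weight_sum_mono:
  "s \<le> s' \<Longrightarrow> 0 \<le> w \<Longrightarrow> weight_sum n s w \<le> weight_sum n s' w"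
  unfolding weight_sum_def by (intro sum_mono2) auto

text \<open>The caps make \<open>2 / (L - 1)\<close> equal to \<open>\<eta> / 4\<close> for the
  first pick and to \<open>\<eta> / (8 * cap1 \<eta>)\<close> for the second. By
  \<open>card_full\<close>, at most half of the guaranteed candidates are then full.
  \<open>shrink\<close> is the loss from \<open>third_choice\<close> at
  \<open>L = cap2 \<eta>\<close>.\<close>

definition cap1 :: "real \<Rightarrow> real" where "cap1 \<eta> = 1 + 8 / \<eta>"
definition cap2 :: "real \<Rightarrow> real" where "cap2 \<eta> = 1 + 16 * cap1 \<eta> / \<eta>"
definition shrink :: "real \<Rightarrow> real" where "shrink \<eta> = \<eta> / (16 * (cap2 \<eta>)\<^sup>2)"

lemma caps:
  assumes "0 < \<eta>" "\<eta> \<le> 1"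
  shows "1 < cap1 \<eta>" "1 < cap2 \<eta>" "cap1 \<eta> \<le> cap2 \<eta>" "0 < shrink \<eta>"
proof -
  show 1: "1 < cap1 \<eta>" using assms by (simp add: cap1_def)
  then show 2: "1 < cap2 \<eta>" using assms by (simp add: cap2_def)
  have "cap1 \<eta> * 1 \<le> cap1 \<eta> * (16 / \<eta>)" using assms 1 by (intro mult_left_mono) auto
  then show "cap1 \<eta> \<le> cap2 \<eta>" by (simp add: cap2_def mult.commute)
  show "0 < shrink \<eta>" using assms 2 by (simp add: shrink_def)
qed

context box_system
begin

lemma capped_mono: "capped L s f \<Longrightarrow> L \<le> L' \<Longrightarrow> capped L' s f"
  unfolding capped_def
  by (meson divide_right_mono mult_right_mono of_nat_0_le_iff order_trans)

text \<open>One pick from the candidates \<open>D\<close>. If it can be completed, its elements join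
  \<open>F\<close>. Otherwise the rest of the set avoids all of \<open>D\<close> that is not full;
  since at most \<open>2 / (L - 1) * card V\<close> vertices are full, the container loses at least
  \<open>c\<close> elements.\<close>

lemma capped_branch:
  fixes L w B W c :: real
  assumes A: "A \<subseteq> V" and D: "D \<subseteq> A" and L: "1 < L" and s: "card V \<le> s * h" "card V \<le> s * k"
    and D_large: "2 / (L - 1) * card V + c \<le> card D"
    and good: "\<And>f. f \<subseteq> D \<Longrightarrow> card f = s \<Longrightarrow> capped L s f \<Longrightarrow>
      count_le t w B (completions S A (F \<union> f)) (J + s) W"
    and bad: "\<And>A'. A' \<subseteq> A \<Longrightarrow> card A' \<le> card A - c \<Longrightarrow> count_le t w B (completions S A' {}) (J + s) W"
    and nonneg: "0 \<le> w" "0 \<le> B" "0 \<le> W"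
  shows "count_le t w B (completions S A F) J (weight_sum (card V) s w * W)"
proof -
  define good_pick where "good_pick f \<longleftrightarrow> f \<subseteq> D \<and> card f = s \<and> capped L s f" for f
  define rest where "rest f = A - (D - full L s f)" for f
  \<comment> \<open>The case is read off from \<open>f\<close> alone: a complete capped pick extends
    \<open>F\<close>, while for any other \<open>f\<close> the container becomes
    \<open>rest f\<close> and \<open>F\<close> is dropped.\<close>
  define \<G> where "\<G> f = (if good_pick f then completions S A (F \<union> f) else completions S (rest f) {})" for f
  have finA: "finite A" using A finite_V finite_subset by blast
  show ?thesis
  proof (rule count_le_branch[where \<G> = \<G>, OF finite_V])
    fix X assume X: "X \<in> completions S A F"
    then have XA: "X \<subseteq> A" by (simp add: completions_def)
    then show "X \<subseteq> V" using A by blast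
    obtain f where f: "f \<subseteq> X \<inter> D" "card f \<le> s" "capped L s f" "card f = s \<or> X \<inter> D - f \<subseteq> full L s f"
    proof (rule capped_pick)
      show "X \<inter> D \<subseteq> V" "0 \<le> L" using \<open>X \<subseteq> V\<close> L by auto
    qed
    have "X - f \<in> \<G> f"
    proof (cases "card f = s")
      case True
      then have "good_pick f" using f by (simp add: good_pick_def)
      then show ?thesis using f XA unfolding \<G>_def
        by (auto intro!: completions_mono[OF X])
    next
      case False
      then have "\<not> good_pick f" by (simp add: good_pick_def)
      moreover have "X - f \<subseteq> rest f" using f False XA by (auto simp: rest_def)
      ultimately show ?thesis unfolding \<G>_def
        by (auto intro!: completions_mono[OF X])
    qed
    then show "\<exists>f\<subseteq>X. card f \<le> s \<and> X - f \<in> \<G> f" using f by blast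
  next
    fix f
    have "\<G> f \<subseteq> Pow A" by (auto simp: \<G>_def completions_def rest_def)
    then show "\<G> f \<subseteq> Pow V" using A by blast
  next
    fix f assume f: "f \<subseteq> V" "card f \<le> s"
    show "count_le t w B (\<G> f) (J + s) W"
    proof (cases "good_pick f")
      case True
      then show ?thesis using good by (simp add: \<G>_def good_pick_def)
    next
      case False
      have "(L - 1) * card (full L s f) \<le> 2 * card V"
        using f s L by (intro card_full) auto
      then have 1: "card (full L s f) \<le> 2 / (L - 1) * card V"
        using L by (simp add: field_simps)
      have finfull: "finite (full L s f)" using finite_V by (simp add: full_def)
      have "card D \<le> card (D - full L s f) + card (full L s f)"
        using finA D finfull by (metis add.commute card_Diff_subset_Int card_Un_le diff_le_self
            Un_Diff_cancel card_mono finite_Diff2 finite_UnI finite_subset Un_upper2 order_trans)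
      then have "c \<le> card (D - full L s f)" using 1 D_large by linarith
      moreover have "card (rest f) = card A - card (D - full L s f)"
        unfolding rest_def using finA D by (intro card_Diff_subset) (auto intro: finite_subset)
      moreover have "card (D - full L s f) \<le> card A"
        using finA D by (intro card_mono) auto
      ultimately have "card (rest f) \<le> card A - c" by linarith
      then show ?thesis using False bad[of "rest f"] by (auto simp: \<G>_def rest_def)
    qed
  qed (use nonneg in auto)
qed

text \<open>The three picks are handled in reverse order: \<open>third\<close> is proved for
  arbitrary picks \<open>f\<close> and \<open>g\<close>, \<open>second\<close> for an arbitrary
  \<open>f\<close>, and then the first pick follows. Every outcome shrinks the container by
  \<open>shrink \<eta> * n\<close>; the cube pays for the three branchings and \<open>3 * s'\<close>
  bounds the number of elements used.\<close>

lemma shrink_step: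
  fixes \<eta> w B W n :: real
  defines "n \<equiv> real (card V)"
  assumes A: "A \<subseteq> V" and dense: "\<eta> * (n * h * k) \<le> card (S \<inter> A \<times> A \<times> A \<times> A)"
    and \<eta>: "0 < \<eta>" "\<eta> \<le> 1"
    and s: "card V \<le> s * h" "card V \<le> s * k" "card V ^ 3 \<le> s ^ 3 * h * k"
    and s': "s \<le> s'" "48 * s \<le> \<eta> * s'"
    and IH: "\<And>A'. A' \<subseteq> A \<Longrightarrow> card A' \<le> card A - shrink \<eta> * n \<Longrightarrow>
      count_le t w B (completions S A' {}) (J + 3 * s') W"
    and nonneg: "0 \<le> w" "0 \<le> B" "0 \<le> W"
  shows "count_le t w B (completions S A {}) J (weight_sum (card V) s' w ^ 3 * W)"
proof -
  define P where "P = weight_sum (card V) s' w"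
  define L1 where "L1 = cap1 \<eta>"
  define L2 where "L2 = cap2 \<eta>"
  define Q1 where "Q1 = S \<inter> A \<times> A \<times> A \<times> A"
  define Q2 where "Q2 f = {q \<in> Q1. c1 q \<in> f}" for f
  define Q3 where "Q3 f g = {q \<in> Q2 f. c2 q \<in> g}" for f g
  \<comment> \<open>Both thresholds are half of the average: \<open>Q1\<close> has at least
    \<open>\<eta> * n * h * k\<close> elements over at most \<open>n\<close> vertices, and
    \<open>Q2 f\<close> then has at least \<open>s * (\<eta> / 2 * h * k)\<close>.\<close>
  define D1 where "D1 = {x \<in> A. \<eta> / 2 * (h * k) \<le> card {q \<in> Q1. c1 q = x}}"
  define D2 where "D2 f = {z \<in> A. \<eta> / 4 * (s * h * k / n) \<le> card {q \<in> Q2 f. c2 q = z}}" for f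
  have n: "0 < n" using card_V_pos by (simp add: n_def)
  have "0 < s * h" "0 < s * k" using s card_V_pos by linarith+
  then have pos: "0 < s" "0 < h" "0 < k" by auto
  have P: "1 \<le> P" "weight_sum (card V) s w \<le> P"
    using weight_sum_ge_1 weight_sum_mono s' nonneg by (auto simp: P_def)
  have L: "1 < L1" "1 < L2" "L1 \<le> L2" and shrink: "0 < shrink \<eta>"
    using caps[OF \<eta>] by (auto simp: L1_def L2_def)
  have L1_eq: "2 / (L1 - 1) = \<eta> / 4" and L2_eq: "2 / (L2 - 1) = \<eta> / (8 * L1)"
  proof -
    have "L1 - 1 = 8 / \<eta>" "L2 - 1 = 16 * L1 / \<eta>" by (simp_all add: L1_def L2_def cap1_def cap2_def)
    then show "2 / (L1 - 1) = \<eta> / 4" "2 / (L2 - 1) = \<eta> / (8 * L1)" using \<eta> L by simp_all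
  qed
  have shrink_le: "shrink \<eta> \<le> \<eta> / (8 * L1)" "shrink \<eta> \<le> \<eta> / 4"
  proof -
    have "L1 * 1 \<le> L2 * L2" using L by (intro mult_mono) auto
    then have "8 * L1 \<le> 16 * L2\<^sup>2"
      using zero_le_square[of L2] unfolding power2_eq_square by linarith
    then show "shrink \<eta> \<le> \<eta> / (8 * L1)"
      unfolding shrink_def L2_def[symmetric] using \<eta> L by (intro divide_left_mono) auto
    also have "\<dots> \<le> \<eta> / 4" using \<eta> L by (intro divide_left_mono) auto
    finally show "shrink \<eta> \<le> \<eta> / 4" .
  qed
  have finA: "finite A" using A finite_V finite_subset by blast
  have cardA: "card A \<le> n" using A finite_V by (simp add: n_def card_mono)
  have finQ: "finite Q1" "finite (Q2 f)" "finite (Q3 f g)" for f g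
    using finite_S by (auto simp: Q1_def Q2_def Q3_def)
  \<comment> \<open>A failed pick ends the round early. It has used fewer elements, and its weight
    bound still contains the factors of the picks not made; \<open>J'\<close> and \<open>W'\<close>
    allow for both.\<close>
  have IH': "count_le t w B (completions S A' {}) J' W'"
    if "A' \<subseteq> A" "card A' \<le> card A - shrink \<eta> * n" "J' \<le> J + 3 * s'" "W \<le> W'" for A' J' W'
    using that nonneg by (intro count_le_mono[OF IH]) auto
  have "1 * W \<le> P * W" "1 * (P * W) \<le> P * (P * W)"
    using P nonneg by (intro mult_right_mono; simp)+
  then have P_le: "W \<le> P * W" "W \<le> P * (P * W)" "0 \<le> P * W" "0 \<le> P * (P * W)"
    using nonneg by linarith+
  have third: "count_le t w B (completions S A ({} \<union> f \<union> g)) (J + s + s) (P * W)"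
    if f: "f \<subseteq> D1" "card f = s" "capped L1 s f" and g: "g \<subseteq> D2 f" "card g = s" "capped L2 s g" for f g
  proof -
    have "real s * (\<eta> / 4 * (s * h * k / n)) \<le> card (Q3 f g)"
      unfolding Q3_def g(2)[symmetric]
      using g finQ by (intro card_fibers_ge) (auto simp: D2_def intro: finite_subset[OF _ finA])
    then have large: "\<eta> / 4 * (s ^ 2 * h * k / n) \<le> card (Q3 f g)"
      by (simp add: power2_eq_square mult_ac)
    have sub: "f \<subseteq> V" "g \<subseteq> V" using f g A by (auto simp: D1_def D2_def)
    have s3: "n ^ 3 \<le> s ^ 3 * h * k" using s(3) unfolding n_def
      by (metis of_nat_le_iff of_nat_power of_nat_mult)
    obtain R where R: "\<And>f. R f \<subseteq> A" "\<And>f. \<eta> / (16 * L2\<^sup>2) * n \<le> card (R f)"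
      "\<And>Y. Y \<in> completions S A (f \<union> g) \<Longrightarrow>
        \<exists>f\<subseteq>Y. card f \<le> s' \<and> Y - f \<in> completions S (A - R f) {}"
      by (rule third_choice[OF A sub capped_mono[OF f(3) L(3)] g(3) _ _ _ large[unfolded n_def] \<eta>(1)
            less_imp_le[OF L(2)] pos s3[unfolded n_def] s'(2)])
        (auto simp: Q1_def Q2_def Q3_def n_def)
    have "count_le t w B (completions S A (f \<union> g)) (J + s + s) (weight_sum (card V) s' w * W)"
    proof (rule count_le_branch[OF finite_V _ R(3)])
      fix f' assume "f' \<subseteq> V" "card f' \<le> s'"
      have "card (A - R f') = card A - card (R f')" "card (R f') \<le> card A"
        using R(1) finA by (auto intro: card_Diff_subset card_mono finite_subset)
      then have "card (A - R f') \<le> card A - shrink \<eta> * n"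
        using R(2)[of f'] by (simp add: shrink_def L2_def)
      then show "count_le t w B (completions S (A - R f') {}) (J + s + s + s') W"
        using s' by (intro IH') auto
    qed (use A nonneg in \<open>auto simp: completions_def\<close>)
    then show ?thesis by (simp add: P_def)
  qed
  have second: "count_le t w B (completions S A ({} \<union> f)) (J + s) (P * (P * W))"
    if f: "f \<subseteq> D1" "card f = s" "capped L1 s f" for f
  proof -
    have fV: "f \<subseteq> V" using f A by (auto simp: D1_def)
    have "card f * (\<eta> / 2 * (h * k)) \<le> card (Q2 f)"
      unfolding Q2_def
      using f finQ by (intro card_fibers_ge) (auto simp: D1_def intro: finite_subset[OF _ finA])
    also have "card (Q2 f) \<le> card (D2 f) * (L1 * s * h / n * k) + card A * (\<eta> / 4 * (s * h * k / n))"
      unfolding D2_def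
    proof (rule card_popular)
      fix z assume "z \<in> A"
      then show "card {q \<in> Q2 f. c2 q = z} \<le> L1 * s * h / n * k"
        using f(3) fV A unfolding n_def
        by (intro card_fiber2[where f = f]) (auto simp: Q2_def Q1_def capped_def)
    qed (use finQ finA \<eta> n in \<open>auto simp: Q2_def Q1_def\<close>)
    also have "card A * (\<eta> / 4 * (s * h * k / n)) \<le> n * (\<eta> / 4 * (s * h * k / n))"
      using cardA \<eta> n by (intro mult_right_mono) auto
    finally have "card f * (\<eta> / 2 * (h * k)) \<le>
        card (D2 f) * (L1 * s * h / n * k) + n * (\<eta> / 4 * (s * h * k / n))" by simp
    moreover have "card f * (\<eta> / 2 * (h * k)) = \<eta> / 2 * (s * h * k)"
      using f(2) by simp
    moreover have "n * (\<eta> / 4 * (s * h * k / n)) = \<eta> / 4 * (s * h * k)"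
      using n by simp
    ultimately have "\<eta> / 4 * (s * h * k) \<le> card (D2 f) * (L1 * s * h / n * k)"
      by linarith
    then have "(s * h * k) * (\<eta> * n) \<le> (s * h * k) * (4 * L1 * card (D2 f))"
      using n by (simp add: field_simps)
    then have "\<eta> * n \<le> 4 * L1 * card (D2 f)"
      using pos by (simp add: mult_le_cancel_left_pos)
    then have "\<eta> / (8 * L1) * n + \<eta> / (8 * L1) * n \<le> card (D2 f)"
      using L by (simp add: field_simps)
    moreover have "shrink \<eta> * n \<le> \<eta> / (8 * L1) * n"
      using shrink_le n by (intro mult_right_mono) auto
    ultimately have "2 / (L2 - 1) * card V + shrink \<eta> * n \<le> card (D2 f)"
      unfolding L2_eq n_def by linarith
    then have "count_le t w B (completions S A ({} \<union> f)) (J + s) (weight_sum (card V) s w * (P * W))"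
      using third[OF f] s' P_le
      by (intro capped_branch[where D = "D2 f" and L = L2, OF A _ L(2) s(1,2)] IH' nonneg) (auto simp: D2_def)
    then show ?thesis
      by (rule count_le_mono) (use P nonneg P_le in \<open>auto intro: mult_right_mono\<close>)
  qed
  have "\<eta> * (n * h * k) \<le> card D1 * real (h * k) + card A * (\<eta> / 2 * (h * k))"
  proof -
    have "card Q1 \<le> card D1 * real (h * k) + card A * (\<eta> / 2 * (h * k))"
      unfolding D1_def
    proof (rule card_popular)
      fix x assume "x \<in> A"
      then show "card {q \<in> Q1. c1 q = x} \<le> real (h * k)"
        using card_fiber1[of Q1 x] A by (auto simp: Q1_def)
    qed (use finQ finA \<eta> in \<open>auto simp: Q1_def\<close>)
    then show ?thesis using dense unfolding Q1_def by linarith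
  qed
  also have "card A * (\<eta> / 2 * (h * k)) \<le> n * (\<eta> / 2 * (h * k))"
    using cardA \<eta> by (intro mult_right_mono) auto
  finally have "(h * k) * (\<eta> / 2 * n) \<le> (h * k) * card D1"
    by (simp add: field_simps)
  then have "\<eta> / 2 * n \<le> card D1"
    using pos by (simp add: mult_le_cancel_left_pos)
  moreover have "shrink \<eta> * n \<le> \<eta> / 4 * n"
    using shrink_le n by (intro mult_right_mono) auto
  ultimately have "2 / (L1 - 1) * card V + shrink \<eta> * n \<le> card D1"
    unfolding L1_eq n_def by linarith
  then have "count_le t w B (completions S A {}) J (weight_sum (card V) s w * (P * (P * W)))"
    using second s' P_le
    by (intro capped_branch[where D = D1 and L = L1, OF A _ L(1) s(1,2)] IH' nonneg) (auto simp: D1_def)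
  then show ?thesis unfolding P_def[symmetric]
    by (rule count_le_mono)
      (use P nonneg P_le in \<open>auto simp: power3_eq_cube mult.assoc intro!: mult_right_mono\<close>)
qed

end

section \<open>Iteration and the binomial estimate\<close>

lemma binomial_Suc_absorb: "Suc u * (N choose Suc u) = (N - u) * (N choose u)"
  using binomial_absorption[of u N] binomial_absorb_comp[of N u] by simp

text \<open>Factor by factor, \<open>c * (D - i) \<le> N - i\<close>. The induction multiplies by
  \<open>Suc u\<close> to stay within the natural numbers.\<close>

lemma choose_le_scaled:
  assumes "c * D \<le> N" "1 \<le> c"
  shows "c ^ u * (D choose u) \<le> N choose u"
proof (induction u)
  case (Suc u)
  have "Suc u * (c ^ Suc u * (D choose Suc u)) = (c * (D - u)) * (c ^ u * (D choose u))"
  proof -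
    have "Suc u * (c ^ Suc u * (D choose Suc u)) = c ^ Suc u * (Suc u * (D choose Suc u))"
      by (simp only: mult.left_commute)
    also have "\<dots> = c ^ Suc u * ((D - u) * (D choose u))" by (simp only: binomial_Suc_absorb)
    finally show ?thesis by (simp add: mult_ac)
  qed
  also have "\<dots> \<le> (N - u) * (N choose u)"
  proof (rule mult_le_mono[OF _ Suc.IH])
    have "c * D - c * u \<le> N - c * u" using assms by (intro diff_le_mono)
    also have "\<dots> \<le> N - u" using assms by (intro diff_le_mono2) auto
    finally have "c * D - c * u \<le> N - u" .
    then show "c * (D - u) \<le> N - u" by (simp add: diff_mult_distrib2)
  qed
  also have "\<dots> = Suc u * (N choose Suc u)" by (rule binomial_Suc_absorb[symmetric])
  finally show ?case by (simp only: mult_le_cancel1)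
qed simp

text \<open>For \<open>v < t \<le> N / 2\<close> the ratio of neighbouring binomials is
  \<open>(v + 1) / (N - v) \<le> 2 * t / N\<close>. This is the weight \<open>w\<close> earned by
  each element of a fingerprint.\<close>

lemma choose_le_gain:
  assumes t: "2 * t \<le> N" "j \<le> t"
  shows "real (N choose (t - j)) \<le> (2 * t / N) ^ j * (N choose t)"
  using t(2)
proof (induction j)
  case (Suc j)
  define v where "v = t - Suc j"
  have v: "t - j = Suc v" "Suc v \<le> t" using Suc.prems by (auto simp: v_def)
  have N: "0 < N" using v t by linarith
  have "real (Suc v * (N choose Suc v)) = real ((N - v) * (N choose v))"
    by (simp only: binomial_Suc_absorb)
  then have "(real N - v) * (N choose v) = Suc v * real (N choose Suc v)"
    using v t by (simp only: of_nat_mult) (simp add: of_nat_diff del: binomial_Suc_Suc)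
  also have "\<dots> \<le> t * real (N choose Suc v)" using v by (intro mult_right_mono) auto
  finally have 1: "(real N - v) * (N choose v) \<le> t * real (N choose Suc v)" .
  have "(N / 2) * (N choose v) \<le> (real N - v) * (N choose v)"
    using v t by (intro mult_right_mono) auto
  with 1 have "(N choose v) \<le> (2 * t / N) * real (N choose Suc v)" using N by (simp add: field_simps)
  also have "\<dots> \<le> (2 * t / N) * ((2 * t / N) ^ j * (N choose t))"
    using Suc v by (intro mult_left_mono) auto
  finally show ?case by (simp add: v_def)
qed simp

context box_system
begin

text \<open>Each of the \<open>r\<close> rounds lowers the size bound by
  \<open>shrink \<eta> * n\<close>, costs three factors \<open>weight_sum\<close> and uses up to
  \<open>3 * s'\<close> levels, hence \<open>J + 3 * r * s' \<le> T\<close>. A container that is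
  already small goes straight to \<open>base\<close>.\<close>

lemma count_le_iterate:
  fixes \<eta> \<gamma> w B n :: real
  defines "n \<equiv> real (card V)"
  assumes dense: "\<And>A. A \<subseteq> V \<Longrightarrow> \<gamma> * n \<le> card A \<Longrightarrow> \<eta> * (n * h * k) \<le> card (S \<inter> A \<times> A \<times> A \<times> A)"
    and base: "\<And>A. A \<subseteq> V \<Longrightarrow> card A \<le> \<gamma> * n \<Longrightarrow> count_le t w B (completions S A {}) T 1"
    and \<eta>: "0 < \<eta>" "\<eta> \<le> 1"
    and s: "card V \<le> s * h" "card V \<le> s * k" "card V ^ 3 \<le> s ^ 3 * h * k"
    and s': "s \<le> s'" "48 * s \<le> \<eta> * s'"
    and nonneg: "0 \<le> w" "0 \<le> B"
  shows "A \<subseteq> V \<Longrightarrow> card A \<le> \<gamma> * n + r * shrink \<eta> * n \<Longrightarrow> J + 3 * r * s' \<le> T \<Longrightarrow>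
    count_le t w B (completions S A {}) J (weight_sum (card V) s' w ^ (3 * r))"
proof (induction r arbitrary: A J)
  case 0
  then show ?case using base[of A] nonneg by (auto intro: count_le_mono)
next
  case (Suc r)
  define P where "P = weight_sum (card V) s' w"
  have P: "1 \<le> P" using weight_sum_ge_1 nonneg by (simp add: P_def)
  show ?case
  proof (cases "card A \<le> \<gamma> * n")
    case True
    show ?thesis unfolding P_def[symmetric]
      by (rule count_le_mono[OF base[OF Suc.prems(1) True]]) (use nonneg P Suc.prems(3) in auto)
  next
    case False
    have "count_le t w B (completions S A {}) J (P ^ 3 * P ^ (3 * r))"
      unfolding P_def
    proof (rule shrink_step[OF Suc.prems(1) _ \<eta> s s'])
      show "\<eta> * (real (card V) * h * k) \<le> card (S \<inter> A \<times> A \<times> A \<times> A)"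
        using dense[OF Suc.prems(1)] False by (simp add: n_def)
      fix A' assume A': "A' \<subseteq> A" "card A' \<le> card A - shrink \<eta> * card V"
      show "count_le t w B (completions S A' {}) (J + 3 * s') (weight_sum (card V) s' w ^ (3 * r))"
      proof (rule Suc.IH)
        show "card A' \<le> \<gamma> * n + r * shrink \<eta> * n"
          using A'(2) Suc.prems(2) by (simp add: n_def algebra_simps)
      qed (use A' Suc.prems in \<open>auto simp: algebra_simps\<close>)
    qed (use nonneg P in \<open>auto simp: P_def\<close>)
    then show ?thesis by (simp add: P_def flip: power_add)
  qed
qed

text \<open>All fingerprints together weigh at most \<open>exp t\<close>. The final containers have
  size at most \<open>N / 16\<close>, which gains a factor \<open>16 ^ (t - j)\<close> in the
  binomial coefficient. Since at most half of the \<open>t\<close> elements are in the fingerprint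
  and \<open>exp 2 \<le> 16\<close>, the gain wins.\<close>

lemma card_avoiding_sets_le:
  fixes \<eta> \<delta> l n :: real and r :: nat
  defines "n \<equiv> real (card V)" and "l \<equiv> 1 + 12 * real r / \<delta>"
  assumes dense: "\<And>A. A \<subseteq> V \<Longrightarrow> \<delta> / 16 * n \<le> card A \<Longrightarrow> \<eta> * (n * h * k) \<le> card (S \<inter> A \<times> A \<times> A \<times> A)"
    and \<eta>: "0 < \<eta>" "\<eta> \<le> 1" and \<delta>: "0 < \<delta>" "1 \<le> \<delta> * n" and r: "1 \<le> r * shrink \<eta>"
    and s: "card V \<le> s * h" "card V \<le> s * k" "card V ^ 3 \<le> s ^ 3 * h * k"
    and s': "s \<le> s'" "48 * s \<le> \<eta> * s'"
    and t: "6 * r * s' \<le> t" "6 * r * s' * ln l \<le> t"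
  shows "card (avoiding_sets V S t) \<le> floor_choose (2 * \<delta> * n) t"
proof -
  define N where "N = nat \<lfloor>2 * \<delta> * n\<rfloor>"
  define w where "w = 2 * real t / real N"
  define P where "P = weight_sum (card V) s' w"
  \<comment> \<open>Dividing by the total weight makes the bound after all rounds exactly
    \<open>N choose t\<close>.\<close>
  define B where "B = (N choose t) / P ^ (3 * r)"
  define T where "T = 3 * r * s'"
  have n: "0 < n" using card_V_pos by (simp add: n_def)
  \<comment> \<open>Rounding down loses at most 1, which is at most
    \<open>\<delta> * n\<close>.\<close>
  have "2 * \<delta> * n - 1 \<le> of_int \<lfloor>2 * \<delta> * n\<rfloor>" by linarith
  then have "\<delta> * n \<le> of_int \<lfloor>2 * \<delta> * n\<rfloor>" using \<delta>(2) by linarith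
  then have N: "\<delta> * n \<le> N" using \<delta> n by (simp add: N_def)
  have N_pos: "0 < N" using N \<delta> by (cases N) auto
  have w: "0 \<le> w" by (simp add: w_def)
  have P: "1 \<le> P" unfolding P_def by (rule weight_sum_ge_1[OF w])
  have l: "1 \<le> l" using \<delta> by (simp add: l_def)
  have P_exp: "P ^ (3 * r) \<le> exp t"
  proof -
    have "P ^ (3 * r) \<le> (l ^ s' * exp (n * w / l)) ^ (3 * r)"
      using P weight_sum_le_exp[OF w l, of "card V" s'] by (intro power_mono) (auto simp: P_def n_def)
    also have "\<dots> = l ^ T * exp (3 * r * (n * w / l))"
      by (simp add: T_def power_mult_distrib mult_ac flip: power_mult exp_of_nat_mult)
    also have "l ^ T = exp (T * ln l)" using l by (simp add: exp_of_nat_mult)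
    also have "\<dots> * exp (3 * r * (n * w / l)) = exp (T * ln l + 3 * r * (n * w / l))"
      by (simp add: exp_add)
    \<comment> \<open>Each summand is at most \<open>t / 2\<close>: the first by the lower bound on
      \<open>t\<close> with \<open>ln l\<close>, the second because \<open>l\<close> is chosen with
      \<open>\<delta> * l = \<delta> + 12 * r\<close>.\<close>
    also have "\<dots> \<le> exp t"
    proof -
      have "n * w \<le> 2 * t / \<delta>"
      proof -
        have "n / N \<le> 1 / \<delta>" using N N_pos \<delta> by (simp add: field_simps)
        then have "2 * t * (n / N) \<le> 2 * t * (1 / \<delta>)" by (intro mult_left_mono) auto
        then show ?thesis by (simp add: w_def mult_ac)
      qed
      then have "3 * r * (n * w / l) \<le> 3 * r * (2 * t / \<delta> / l)"
        using l by (intro mult_left_mono divide_right_mono) auto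
      also have "\<dots> = 6 * real r / \<delta> / l * real t" by simp
      also have "\<dots> \<le> 1 / 2 * real t"
      proof (rule mult_right_mono)
        have "\<delta> * l = \<delta> + 12 * r" using \<delta> by (simp add: l_def distrib_left)
        then show "6 * real r / \<delta> / l \<le> 1 / 2" using \<delta> by (simp add: divide_le_eq)
      qed simp
      finally have "3 * r * (n * w / l) \<le> t / 2" by simp
      moreover have "T * ln l \<le> t / 2" using t(2) by (simp add: T_def)
      ultimately show ?thesis by simp
    qed
    finally show ?thesis .
  qed
  have base: "count_le t w B (completions S A {}) T 1"
    if A: "A \<subseteq> V" "card A \<le> \<delta> / 16 * n" for A
    unfolding count_le_def
  proof (intro allI impI)
    fix j assume j: "j \<le> T" "j \<le> t"
    have finA: "finite A" using A finite_V finite_subset by blast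
    have "card {X \<in> completions S A {}. card X = t - j} \<le> card {X. X \<subseteq> A \<and> card X = t - j}"
      using finA by (intro card_mono) (auto simp: completions_def)
    also have "\<dots> = card A choose (t - j)" by (rule n_subsets[OF finA])
    finally have 1: "card {X \<in> completions S A {}. card X = t - j} \<le> card A choose (t - j)" .
    have "real (card A choose (t - j)) \<le> 1 * w ^ j * B"
    proof (cases "card A < t - j")
      case True
      then show ?thesis using w P by (simp add: binomial_eq_0 B_def)
    next
      case False
      have "real (16 * card A) \<le> real N" using A(2) N by simp
      then have N16: "16 * card A \<le> N" by linarith
      have "2 * j \<le> t" using j t(1) by (simp add: T_def)
      \<comment> \<open>In this case
        \<open>t \<le> 2 * (t - j) \<le> 2 * card A \<le> N / 8\<close>, so
        \<open>choose_le_gain\<close> applies.\<close>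
      then have t2: "2 * t \<le> N" "t \<le> 2 * (t - j)" using False N16 by linarith+
      have "P ^ (3 * r) * real (card A choose (t - j)) \<le> 16 ^ (t - j) * real (card A choose (t - j))"
      proof (rule mult_right_mono)
        have "exp 2 = exp 1 * exp (1::real)" by (simp flip: exp_add)
        also have "\<dots> \<le> 3 * 3" using exp_le by (intro mult_mono) auto
        finally have exp_2_le: "exp 2 \<le> (16::real)" by simp
        have "exp (real t) \<le> exp (real (t - j) * 2)" using t2(2) by simp
        also have "\<dots> = exp 2 ^ (t - j)" by (rule exp_of_nat_mult)
        also have "\<dots> \<le> 16 ^ (t - j)" using exp_2_le by (rule power_mono) simp
        finally show "P ^ (3 * r) \<le> 16 ^ (t - j)" using P_exp by linarith
      qed simp
      also have "\<dots> = real (16 ^ (t - j) * (card A choose (t - j)))" by simp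
      also have "\<dots> \<le> real (N choose (t - j))"
        using choose_le_scaled[OF N16] by (simp only: of_nat_le_iff)
      also have "\<dots> \<le> w ^ j * (N choose t)"
        unfolding w_def by (rule choose_le_gain[OF t2(1) j(2)])
      finally show ?thesis using P by (simp add: B_def field_simps)
    qed
    then show "real (card {X \<in> completions S A {}. card X = t - j}) \<le> 1 * w ^ j * B"
      using 1 by linarith
  qed
  have "1 * n \<le> r * shrink \<eta> * n" using r n by (intro mult_right_mono) auto
  then have "card V \<le> \<delta> / 16 * n + r * shrink \<eta> * n"
    using \<delta> by (simp add: n_def)
  then have "count_le t w B (completions S V {}) 0 (P ^ (3 * r))"
    unfolding P_def n_def
    using dense base w P
    by (intro count_le_iterate[where T = T and \<gamma> = "\<delta> / 16", OF _ _ \<eta> s s'])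
       (auto simp: n_def T_def B_def)
  moreover have "avoiding_sets V S t = {X \<in> completions S V {}. card X = t - 0}"
    by (auto simp: avoiding_sets_def completions_def)
  ultimately have "real (card (avoiding_sets V S t)) \<le> P ^ (3 * r) * w ^ 0 * B"
    unfolding count_le_def by simp
  also have "\<dots> = real (N choose t)" using P by (simp add: B_def)
  finally show ?thesis by (simp add: floor_choose_def N_def)
qed

end

section \<open>Parallelograms in abelian groups\<close>

context comm_group
begin

lemma sum_translate:
  assumes "a \<in> carrier G"
  shows "(\<Sum>x\<in>carrier G. f (x \<otimes> a)) = (\<Sum>x\<in>carrier G. f x)"
proof (rule sum.reindex_bij_betw)
  show "bij_betw (\<lambda>x. x \<otimes> a) (carrier G) (carrier G)"
    by (rule bij_betw_byWitness[where f' = "\<lambda>x. x \<otimes> inv a"]) (use assms in \<open>auto simp: m_assoc\<close>)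
qed

lemma sum_translate_subgroup:
  assumes K: "subgroup K G" and b: "b \<in> K"
  shows "(\<Sum>c\<in>K. f (b \<otimes> c)) = (\<Sum>c\<in>K. f c)"
proof (rule sum.reindex_bij_betw)
  have K': "c \<in> carrier G" if "c \<in> K" for c using K that by (rule subgroup.mem_carrier)
  show "bij_betw (\<lambda>c. b \<otimes> c) K K"
    by (rule bij_betw_byWitness[where f' = "\<lambda>x. inv b \<otimes> x"])
      (use b in \<open>auto simp: K' simp flip: m_assoc
         intro: subgroup.m_closed[OF K] subgroup.m_inv_closed[OF K]\<close>)
qed

text \<open>Cauchy-Schwarz for the coset sums \<open>F\<close>. Their total is \<open>card K\<close>
  times that of \<open>f\<close>. As \<open>F\<close> is constant on cosets of \<open>K\<close>,
  translation turns the sum of its squares into \<open>card K * C\<close>.\<close>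

lemma subgroup_correlation:
  fixes f :: "'a \<Rightarrow> real"
  assumes fin: "finite (carrier G)" and K: "subgroup K G"
  shows "card K * (\<Sum>x\<in>carrier G. f x)\<^sup>2 \<le> order G * (\<Sum>x\<in>carrier G. \<Sum>b\<in>K. f x * f (x \<otimes> b))"
proof -
  define F where "F x = (\<Sum>b\<in>K. f (x \<otimes> b))" for x
  define C where "C = (\<Sum>x\<in>carrier G. f x * F x)"
  have K': "c \<in> carrier G" if "c \<in> K" for c using K that by (rule subgroup.mem_carrier)
  have k: "0 < card K"
    using subgroup.one_closed[OF K] finite_subset[OF subgroup.subset[OF K] fin] by (auto simp: card_gt_0_iff)
  have "(\<Sum>x\<in>carrier G. F x) = (\<Sum>b\<in>K. \<Sum>x\<in>carrier G. f (x \<otimes> b))"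
    unfolding F_def by (rule sum.swap)
  also have "\<dots> = card K * (\<Sum>x\<in>carrier G. f x)"
    using K' by (simp add: sum_translate)
  finally have F_sum: "(\<Sum>x\<in>carrier G. F x) = card K * (\<Sum>x\<in>carrier G. f x)" .
  have F_shift: "F x = F (x \<otimes> b)" if "x \<in> carrier G" "b \<in> K" for x b
    using sum_translate_subgroup[OF K \<open>b \<in> K\<close>, of "\<lambda>c. f (x \<otimes> c)"] that K'
    by (simp add: F_def m_assoc)
  have "(\<Sum>x\<in>carrier G. (F x)\<^sup>2) = (\<Sum>x\<in>carrier G. \<Sum>b\<in>K. f (x \<otimes> b) * F (x \<otimes> b))"
  proof (rule sum.cong[OF refl])
    fix x assume x: "x \<in> carrier G"
    have "(F x)\<^sup>2 = (\<Sum>b\<in>K. f (x \<otimes> b) * F x)"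
      by (simp add: F_def power2_eq_square sum_distrib_right)
    then show "(F x)\<^sup>2 = (\<Sum>b\<in>K. f (x \<otimes> b) * F (x \<otimes> b))"
      using F_shift[OF x] by simp
  qed
  also have "\<dots> = (\<Sum>b\<in>K. \<Sum>x\<in>carrier G. f (x \<otimes> b) * F (x \<otimes> b))" by (rule sum.swap)
  also have "\<dots> = (\<Sum>b\<in>K. C)"
    unfolding C_def by (intro sum.cong refl sum_translate[where f = "\<lambda>x. f x * F x"] K')
  finally have "(\<Sum>x\<in>carrier G. (F x)\<^sup>2) = card K * C" by simp
  then have "(card K * (\<Sum>x\<in>carrier G. f x))\<^sup>2 \<le> card K * C * order G"
    using sum_squared_le_sum_of_squares[of F "carrier G"] by (simp add: F_sum order_def)
  then have "card K * (card K * (\<Sum>x\<in>carrier G. f x)\<^sup>2) \<le> card K * (order G * C)"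
    by (simp add: power2_eq_square mult_ac)
  then have "card K * (\<Sum>x\<in>carrier G. f x)\<^sup>2 \<le> order G * C"
    using k by (simp add: mult_le_cancel_left_pos)
  then show ?thesis by (simp add: C_def F_def sum_distrib_left)
qed

text \<open>\<open>subgroup_correlation\<close> is used twice: with \<open>H\<close> for the
  indicator of \<open>A\<close>, which bounds the sum of all \<open>s a\<close> from below, and with
  \<open>K\<close> for \<open>g a\<close>, the indicator of the \<open>x\<close> with
  \<open>x\<close> and \<open>x \<otimes> a\<close> in \<open>A\<close>. Cauchy-Schwarz over
  \<open>a \<in> H\<close> links the two.\<close>

lemma card_parallelograms_ge:
  assumes fin: "finite (carrier G)" and H: "subgroup H G" and K: "subgroup K G" and A: "A \<subseteq> carrier G"
  shows "card H * card K * card A ^ 4 \<le> order G ^ 3 *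
    card {(x, a, b) \<in> carrier G \<times> H \<times> K. x \<in> A \<and> x \<otimes> a \<in> A \<and> x \<otimes> b \<in> A \<and> x \<otimes> a \<otimes> b \<in> A}"
    (is "_ \<le> _ * card ?P")
proof -
  define n h k where "n = real (order G)" and "h = real (card H)" and "k = real (card K)"
  define i where "i x = (of_bool (x \<in> A) :: real)" for x
  define g where "g a x = i x * i (x \<otimes> a)" for a x
  define s where "s a = (\<Sum>x\<in>carrier G. g a x)" for a
  have H': "c \<in> carrier G" if "c \<in> H" for c using H that by (rule subgroup.mem_carrier)
  have K': "c \<in> carrier G" if "c \<in> K" for c using K that by (rule subgroup.mem_carrier)
  have finH: "finite H" and finK: "finite K"
    using H K fin by (meson finite_subset subgroup.subset)+
  have h: "0 < h" using subgroup.one_closed[OF H] finH by (auto simp: h_def card_gt_0_iff)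
  have n: "0 < n" using fin by (auto simp: n_def order_def card_gt_0_iff)
  have "(\<Sum>x\<in>carrier G. i x) = card (carrier G \<inter> A)" using fin by (simp add: i_def Int_def)
  also have "carrier G \<inter> A = A" using A by blast
  finally have sum_i: "(\<Sum>x\<in>carrier G. i x) = card A" .
  have "(\<Sum>a\<in>H. s a) = (\<Sum>x\<in>carrier G. \<Sum>a\<in>H. i x * i (x \<otimes> a))"
    unfolding s_def g_def by (rule sum.swap)
  then have sum_s: "h * card A ^ 2 \<le> n * (\<Sum>a\<in>H. s a)"
    using subgroup_correlation[OF fin H, of i] by (simp add: sum_i h_def n_def)
  have "card ?P = (\<Sum>a\<in>H. \<Sum>x\<in>carrier G. \<Sum>b\<in>K. g a x * g a (x \<otimes> b))"
  proof -
    have "real (card ?P) = (\<Sum>(x, a, b)\<in>carrier G \<times> H \<times> K.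
        of_bool (x \<in> A \<and> x \<otimes> a \<in> A \<and> x \<otimes> b \<in> A \<and> x \<otimes> a \<otimes> b \<in> A))"
      using fin finH finK by (simp add: case_prod_unfold Int_def mem_Times_iff conj_assoc)
    also have "\<dots> = (\<Sum>x\<in>carrier G. \<Sum>a\<in>H. \<Sum>b\<in>K. g a x * g a (x \<otimes> b))"
      unfolding sum.cartesian_product[symmetric]
      using H' K' by (intro sum.cong refl) (auto simp: g_def i_def m_ac)
    also have "\<dots> = (\<Sum>a\<in>H. \<Sum>x\<in>carrier G. \<Sum>b\<in>K. g a x * g a (x \<otimes> b))"
      by (rule sum.swap)
    finally show ?thesis .
  qed
  then have "n * card ?P = (\<Sum>a\<in>H. n * (\<Sum>x\<in>carrier G. \<Sum>b\<in>K. g a x * g a (x \<otimes> b)))"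
    by (simp add: sum_distrib_left)
  also have "\<dots> \<ge> (\<Sum>a\<in>H. k * (s a)\<^sup>2)"
    unfolding s_def n_def k_def by (intro sum_mono subgroup_correlation[OF fin K])
  finally have 1: "k * (\<Sum>a\<in>H. (s a)\<^sup>2) \<le> n * card ?P" by (simp add: sum_distrib_left)
  have "k * (h * card A ^ 2)\<^sup>2 \<le> k * (n * (\<Sum>a\<in>H. s a))\<^sup>2"
    using sum_s h by (intro mult_left_mono power_mono) (auto simp: k_def)
  also have "\<dots> \<le> k * (n ^ 2 * ((\<Sum>a\<in>H. (s a)\<^sup>2) * h))"
    using sum_squared_le_sum_of_squares[of s H]
    by (simp only: power_mult_distrib) (intro mult_left_mono, auto simp: k_def h_def)
  also have "\<dots> = n ^ 2 * h * (k * (\<Sum>a\<in>H. (s a)\<^sup>2))" by simp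
  also have "\<dots> \<le> n ^ 2 * h * (n * card ?P)"
    using 1 h by (intro mult_left_mono) auto
  finally have "h * (h * k * card A ^ 4) \<le> h * (n ^ 3 * card ?P)"
    by (simp add: power_mult_distrib power3_eq_cube power2_eq_square power4_eq_xxxx mult_ac)
  then have "h * k * card A ^ 4 \<le> n ^ 3 * card ?P" using h by (simp add: mult_le_cancel_left_pos)
  then have "real (card H * card K * card A ^ 4) \<le> real (order G ^ 3 * card ?P)"
    by (simp add: h_def k_def n_def)
  then show ?thesis by (simp only: of_nat_le_iff)
qed

section \<open>Nondegenerate parallelograms as a box system\<close>

lemma mem_parallelograms:
  "(x, z, y, w) \<in> parallelograms G H K \<longleftrightarrow>
    (\<exists>a\<in>H. \<exists>b\<in>K. x \<in> carrier G \<and> z = x \<otimes> a \<and> y = x \<otimes> b \<and> w = x \<otimes> a \<otimes> b)"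
  by (auto simp: parallelograms_def)

lemma mem_distinct_parallelograms:
  "(x, z, y, w) \<in> distinct_tuples (parallelograms G H K) \<longleftrightarrow>
    (x, z, y, w) \<in> parallelograms G H K \<and> distinct [x, z, y, w]"
  by (auto simp: distinct_tuples_def)

text \<open>Two vertices coincide only if \<open>a\<close> or \<open>b\<close> is trivial,
  \<open>a = b\<close>, or \<open>b\<close> is the inverse of \<open>a\<close>. The sets
  \<open>B1\<close> to \<open>B4\<close> cover these cases; in the last two \<open>a\<close>
  determines \<open>b\<close>.\<close>

lemma card_distinct_parallelograms_ge:
  fixes A :: "'a set"
  assumes fin: "finite (carrier G)" and H: "subgroup H G" and K: "subgroup K G"
  defines "P \<equiv> {(x, a, b) \<in> carrier G \<times> H \<times> K. x \<in> A \<and> x \<otimes> a \<in> A \<and> x \<otimes> b \<in> A \<and> x \<otimes> a \<otimes> b \<in> A}"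
  shows "card P \<le> card (distinct_tuples (parallelograms G H K) \<inter> A \<times> A \<times> A \<times> A)
    + order G * (card K + 3 * card H)"
proof -
  let ?S = "distinct_tuples (parallelograms G H K) \<inter> A \<times> A \<times> A \<times> A"
  define good where "good = {(x, a, b) \<in> P. a \<noteq> \<one> \<and> b \<noteq> \<one> \<and> a \<noteq> b \<and> a \<otimes> b \<noteq> \<one>}"
  define B1 where "B1 = carrier G \<times> {\<one>} \<times> K"
  define B2 where "B2 = carrier G \<times> H \<times> {\<one>}"
  define B3 where "B3 = (\<lambda>(x, a). (x, a, a)) ` (carrier G \<times> H)"
  define B4 where "B4 = (\<lambda>(x, a). (x, a, inv a)) ` (carrier G \<times> H)"
  have H': "c \<in> carrier G" if "c \<in> H" for c using H that by (rule subgroup.mem_carrier)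
  have K': "c \<in> carrier G" if "c \<in> K" for c using K that by (rule subgroup.mem_carrier)
  have finH: "finite H" and finK: "finite K"
    using H K fin by (meson finite_subset subgroup.subset)+
  have finP: "finite P"
    by (rule finite_subset[of _ "carrier G \<times> H \<times> K"]) (use fin finH finK in \<open>auto simp: P_def\<close>)
  have finB: "finite B1" "finite B2" "finite B3" "finite B4"
    using fin finH finK by (auto simp: B1_def B2_def B3_def B4_def)
  have fingood: "finite good" by (rule finite_subset[OF _ finP]) (auto simp: good_def)
  have cardB: "card B1 = order G * card K" "card B2 = order G * card H"
      "card B3 \<le> order G * card H" "card B4 \<le> order G * card H"
    using card_image_le[of "carrier G \<times> H"] fin finH
    by (auto simp: B1_def B2_def B3_def B4_def order_def card_cartesian_product)
  have "P \<subseteq> good \<union> (B1 \<union> (B2 \<union> (B3 \<union> B4)))"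
  proof
    fix p assume p: "p \<in> P"
    obtain x a b where p': "p = (x, a, b)" by (cases p)
    have ab: "x \<in> carrier G" "a \<in> H" "b \<in> K" using p p' by (auto simp: P_def)
    have "b = inv a" if "a \<otimes> b = \<one>"
      using that ab H' K' by (metis inv_equality m_comm)
    then show "p \<in> good \<union> (B1 \<union> (B2 \<union> (B3 \<union> B4)))"
      using p p' ab by (auto simp: good_def B1_def B2_def B3_def B4_def)
  qed
  then have "card P \<le> card (good \<union> (B1 \<union> (B2 \<union> (B3 \<union> B4))))"
    using finP finB fingood by (intro card_mono) auto
  also have "\<dots> \<le> card good + (card B1 + (card B2 + (card B3 + card B4)))"
    by (intro order_trans[OF card_Un_le] add_mono le_refl)
  also have "\<dots> \<le> card good + order G * (card K + 3 * card H)"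
    using cardB by (simp add: algebra_simps)
  also have "card good \<le> card ?S"
  proof (rule card_inj_on_le[where f = "\<lambda>(x, a, b). (x, x \<otimes> a, x \<otimes> b, x \<otimes> a \<otimes> b)"])
    show "inj_on (\<lambda>(x, a, b). (x, x \<otimes> a, x \<otimes> b, x \<otimes> a \<otimes> b)) good"
      by (auto simp: inj_on_def good_def P_def H' K')
    show "(\<lambda>(x, a, b). (x, x \<otimes> a, x \<otimes> b, x \<otimes> a \<otimes> b)) ` good \<subseteq> ?S"
    proof clarify
      fix x a b assume g: "(x, a, b) \<in> good"
      then have c: "x \<in> carrier G" "a \<in> H" "b \<in> K" "a \<in> carrier G" "b \<in> carrier G"
        "a \<noteq> \<one>" "b \<noteq> \<one>" "a \<noteq> b" "a \<otimes> b \<noteq> \<one>"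
        by (auto simp: good_def P_def H' K')
      have "x \<noteq> x \<otimes> a" "x \<noteq> x \<otimes> b" "x \<otimes> a \<noteq> x \<otimes> b" "x \<otimes> a \<noteq> x \<otimes> a \<otimes> b"
        using c by (simp_all add: r_cancel_one l_cancel_one')
      moreover have "x \<otimes> b \<noteq> x \<otimes> a \<otimes> b" "x \<noteq> x \<otimes> a \<otimes> b"
        using c by (simp_all add: m_assoc l_cancel_one')
      ultimately show "(x, x \<otimes> a, x \<otimes> b, x \<otimes> a \<otimes> b) \<in> ?S"
        using g c by (auto simp: mem_distinct_parallelograms mem_parallelograms good_def P_def)
    qed
    have "?S \<subseteq> A \<times> A \<times> A \<times> A \<inter> carrier G \<times> carrier G \<times> carrier G \<times> carrier G"
      by (auto simp: mem_distinct_parallelograms mem_parallelograms H' K')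
    then show "finite ?S" using fin by (meson finite_Int finite_SigmaI finite_subset)
  qed
  finally show ?thesis by simp
qed

lemma card_distinct_parallelograms_le:
  assumes fin: "finite (carrier G)" and H: "subgroup H G" and K: "subgroup K G"
  shows "card (distinct_tuples (parallelograms G H K)) \<le> order G * card H * card K"
proof -
  let ?f = "\<lambda>(x, a, b). (x, x \<otimes> a, x \<otimes> b, x \<otimes> a \<otimes> b)"
  have fin': "finite (carrier G \<times> H \<times> K)"
    using H K fin by (meson finite_SigmaI finite_subset subgroup.subset)
  have "distinct_tuples (parallelograms G H K) \<subseteq> ?f ` (carrier G \<times> H \<times> K)"
    by (force simp: mem_distinct_parallelograms mem_parallelograms)
  then have "card (distinct_tuples (parallelograms G H K)) \<le> card (?f ` (carrier G \<times> H \<times> K))"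
    using fin' by (intro card_mono) auto
  also have "\<dots> \<le> card (carrier G \<times> H \<times> K)" using fin' by (rule card_image_le)
  finally show ?thesis by (simp add: card_cartesian_product order_def mult.assoc)
qed

lemma parallelogram_box_system:
  assumes fin: "finite (carrier G)" and H: "subgroup H G" and K: "subgroup K G"
  shows "box_system (carrier G) (\<lambda>x. x <# H) (\<lambda>x. x <# K)
    (distinct_tuples (parallelograms G H K)) (card H) (card K)"
proof -
  let ?S = "distinct_tuples (parallelograms G H K)"
  have H': "c \<in> carrier G" if "c \<in> H" for c using H that by (rule subgroup.mem_carrier)
  have K': "c \<in> carrier G" if "c \<in> K" for c using K that by (rule subgroup.mem_carrier)
  have finH: "finite H" and finK: "finite K"
    using H K fin by (meson finite_subset subgroup.subset)+
  have S: "x \<in> carrier G \<and> z \<in> carrier G \<and> y \<in> carrier G \<and> w \<in> carrier G \<and> x \<otimes> w = z \<otimes> y \<and>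
      z \<in> x <# H \<and> y \<in> x <# K \<and> w \<in> y <# H \<and> w \<in> z <# K"
    if quad: "(x, z, y, w) \<in> ?S" for x z y w
  proof -
    obtain a b where ab: "a \<in> H" "b \<in> K" "x \<in> carrier G" "z = x \<otimes> a" "y = x \<otimes> b" "w = x \<otimes> a \<otimes> b"
      using quad unfolding mem_distinct_parallelograms mem_parallelograms by blast
    then have c: "a \<in> carrier G" "b \<in> carrier G" by (simp_all add: H' K')
    then have "w = y \<otimes> a" "w = z \<otimes> b" "x \<otimes> w = z \<otimes> y" using ab by (simp_all add: m_ac)
    moreover from this have "z \<in> x <# H" "y \<in> x <# K" "w \<in> y <# H" "w \<in> z <# K"
      using ab unfolding l_coset_def by blast+
    ultimately show ?thesis using ab c by simp
  qed
  have coset_card: "card (u <# M) \<le> card M" if "finite M" for u M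
  proof -
    have "u <# M = (\<lambda>m. u \<otimes> m) ` M" by (auto simp: l_coset_def)
    then show ?thesis using that by (simp add: card_image_le)
  qed
  have sub: "u <# M \<subseteq> carrier G" if "u \<in> carrier G" "subgroup M G" for u M
    using that by (intro l_coset_subset_G subgroup.subset)
  have refl: "u \<in> u <# M" if "u \<in> carrier G" "subgroup M G" for u M
    using that subgroup.one_closed[OF that(2)] by (force simp: l_coset_def)
  show ?thesis
  proof
    show "carrier G \<noteq> {}" by blast
    show "?S \<subseteq> carrier G \<times> carrier G \<times> carrier G \<times> carrier G" using S by auto
    show "x' = x" if "(x, z, y, w) \<in> ?S" "(x', z, y, w) \<in> ?S" for x x' z y w
      using S[OF that(1)] S[OF that(2)] by (metis right_cancel)
    show "z' = z" if "(x, z, y, w) \<in> ?S" "(x, z', y, w) \<in> ?S" for x z' z y w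
      using S[OF that(1)] S[OF that(2)] by (metis right_cancel)
    show "y' = y" if "(x, z, y, w) \<in> ?S" "(x, z, y', w) \<in> ?S" for x z y' y w
      using S[OF that(1)] S[OF that(2)] by (metis Units_eq Units_l_cancel)
    show "w' = w" if "(x, z, y, w) \<in> ?S" "(x, z, y, w') \<in> ?S" for x z w' y w
      using S[OF that(1)] S[OF that(2)] by (metis Units_eq Units_l_cancel)
    \<comment> \<open>Sharing the side from \<open>y\<close> to \<open>w\<close> forces
      \<open>a' = a\<close>, so \<open>x'\<close> and \<open>z'\<close> are the translates of
      \<open>x\<close> and \<open>z\<close> by \<open>b \<otimes> inv b'\<close>, an element of
      \<open>K\<close>. The coincidences not listed among the alternatives are excluded by
      distinctness or reduce to \<open>x' = x\<close>.\<close>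
    show "x' = x \<or> x' = z \<or> z' = x \<or> (x, z, x', z') \<in> ?S"
      if S1: "(x, z, y, w) \<in> ?S" and S2: "(x', z', y, w) \<in> ?S" for x z y w x' z'
    proof -
      obtain a b where ab: "a \<in> H" "b \<in> K" "z = x \<otimes> a" "y = x \<otimes> b" "w = x \<otimes> a \<otimes> b"
        using S1 by (auto simp: mem_distinct_parallelograms mem_parallelograms)
      obtain a' b' where ab': "a' \<in> H" "b' \<in> K" "z' = x' \<otimes> a'" "y = x' \<otimes> b'" "w = x' \<otimes> a' \<otimes> b'"
        using S2 by (auto simp: mem_distinct_parallelograms mem_parallelograms)
      have c: "x \<in> carrier G" "x' \<in> carrier G" "y \<in> carrier G" "a \<in> carrier G" "b \<in> carrier G"
        "a' \<in> carrier G" "b' \<in> carrier G"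
        using S[OF S1] S[OF S2] ab ab' H' K' by auto
      have "y \<otimes> a = w" "y \<otimes> a' = w" using ab ab' c by (simp_all add: m_ac)
      then have a': "a' = a" using c by (metis Units_eq Units_l_cancel)
      have "x' = y \<otimes> inv b'" using ab'(4) c by (simp add: m_assoc)
      then have x': "x' = x \<otimes> (b \<otimes> inv b')" using ab(4) c by (simp add: m_assoc)
      have z': "z' = x \<otimes> a \<otimes> (b \<otimes> inv b')" using ab'(3) a' x' c by (simp add: m_ac)
      have "b \<otimes> inv b' \<in> K" using ab ab' K by (simp add: subgroup.m_closed subgroup.m_inv_closed)
      then have par: "(x, z, x', z') \<in> parallelograms G H K"
        using ab(1,3) c x' z' by (auto simp: mem_parallelograms)
      have "x \<noteq> z" "x' \<noteq> z'" using S1 S2 by (auto simp: mem_distinct_parallelograms)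
      moreover have "z = z' \<Longrightarrow> x = x'" using ab(3) ab'(3) a' c by simp
      ultimately show ?thesis using par by (auto simp: mem_distinct_parallelograms)
    qed
    show "u <# H \<subseteq> carrier G" "u <# K \<subseteq> carrier G" "u \<in> u <# H" "u \<in> u <# K"
      if "u \<in> carrier G" for u
      using sub refl H K that by simp_all
    show "v <# H = u <# H" if "u \<in> carrier G" "v \<in> u <# H" for u v
      by (rule l_repr_independence[OF that(2,1) H, symmetric])
    show "v <# K = u <# K" if "u \<in> carrier G" "v \<in> u <# K" for u v
      by (rule l_repr_independence[OF that(2,1) K, symmetric])
  qed (use S fin finH finK coset_card in auto)
qed

end

section \<open>Choice of the constants\<close>

definition box_density :: "real \<Rightarrow> real" where
  "box_density \<delta> = (\<delta> / 16) ^ 4 / 2"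

text \<open>Each round removes at least the fraction \<open>shrink\<close> of \<open>V\<close>, so
  this many rounds suffice for every container.\<close>

definition rounds :: "real \<Rightarrow> nat" where
  "rounds \<delta> = nat \<lceil>1 / shrink (box_density \<delta>)\<rceil>"

text \<open>The ratio of \<open>s'\<close> to \<open>s\<close> that
  \<open>48 * s \<le> \<eta> * s'\<close> demands.\<close>

definition pick_factor :: "real \<Rightarrow> nat" where
  "pick_factor \<delta> = nat \<lceil>48 / box_density \<delta>\<rceil>"

text \<open>The leading \<open>\<delta>\<close> cancels against the quotient
  \<open>C / \<delta>\<close>. The 12 is 6 * 2, because rounding up at most doubles the cube root,
  and the factor \<open>1 + ln\<close> dominates both 1 and the logarithm, which serves both lower
  bounds on \<open>t\<close>.\<close>

definition threshold :: "real \<Rightarrow> real" where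
  "threshold \<delta> = \<delta> * (12 * rounds \<delta> * pick_factor \<delta> * (1 + ln (1 + 12 * real (rounds \<delta>) / \<delta>)))"

lemma constants:
  assumes "0 < \<delta>" "\<delta> < 1"
  shows "0 < box_density \<delta>" "box_density \<delta> \<le> 1"
    "1 \<le> rounds \<delta> * shrink (box_density \<delta>)" "0 < rounds \<delta>"
    "48 \<le> box_density \<delta> * pick_factor \<delta>" "0 < pick_factor \<delta>" "0 < threshold \<delta>"
proof -
  show d: "0 < box_density \<delta>" using assms by (simp add: box_density_def)
  have "(\<delta> / 16) ^ 4 \<le> 1" using assms by (intro power_le_one) auto
  then show d1: "box_density \<delta> \<le> 1" by (simp add: box_density_def)
  have sh: "0 < shrink (box_density \<delta>)" by (rule caps(4)[OF d d1])
  have "1 / shrink (box_density \<delta>) \<le> rounds \<delta>"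
    unfolding rounds_def by (rule real_nat_ceiling_ge)
  then show "1 \<le> rounds \<delta> * shrink (box_density \<delta>)" using sh by (simp add: divide_le_eq)
  then show r: "0 < rounds \<delta>" by (cases "rounds \<delta>") auto
  have "48 / box_density \<delta> \<le> pick_factor \<delta>"
    unfolding pick_factor_def by (rule real_nat_ceiling_ge)
  then show "48 \<le> box_density \<delta> * pick_factor \<delta>" using d by (simp add: divide_le_eq mult.commute)
  then show p: "0 < pick_factor \<delta>" by (cases "pick_factor \<delta>") auto
  have "0 \<le> ln (1 + 12 * real (rounds \<delta>) / \<delta>)" using assms by (intro ln_ge_zero) auto
  then have "0 < 1 + ln (1 + 12 * real (rounds \<delta>) / \<delta>)" by linarith
  then show "0 < threshold \<delta>"
    unfolding threshold_def using assms r p by (intro mult_pos_pos) auto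
qed

section \<open>Deduction of the theorem\<close>

lemma powr_third_power3:
  fixes x :: real
  assumes "0 < x"
  shows "(x powr (1/3)) ^ 3 = x" "(x powr (2/3)) ^ 3 = x\<^sup>2"
  using assms by (simp_all add: powr_power)

text \<open>The pick size \<open>s\<close> is \<open>\<sigma>\<close> rounded up, where
  \<open>\<sigma> ^ 3 = n ^ 4 / m\<close>. The condition on the maximum ensures that
  \<open>s * h\<close> and \<open>s * k\<close> reach \<open>n\<close>, so an average row or column
  meets a pick at least once.\<close>

lemma (in comm_group) card_avoiding_parallelograms_le:
  fixes \<delta> :: real and t :: nat and H K :: "'a set"
  defines "S \<equiv> distinct_tuples (parallelograms G H K)"
  assumes fin: "finite (carrier G)" and H: "subgroup H G" and K: "subgroup K G"
    and \<delta>: "0 < \<delta>" "\<delta> < 1" and order_large: "1 \<le> \<delta> * order G"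
    and H_large: "8 \<le> (\<delta> / 16) ^ 4 * card H" and K_large: "8 \<le> (\<delta> / 16) ^ 4 * card K"
    and max: "max (card H) (card K) \<le> (card S / order G) powr (2/3)"
    and t: "threshold \<delta> / \<delta> * (real (order G) ^ 4 / card S) powr (1/3) < t"
  shows "card (avoiding_sets (carrier G) S t) \<le> floor_choose (2 * \<delta> * order G) t"
proof -
  interpret box_system "carrier G" "\<lambda>x. x <# H" "\<lambda>x. x <# K" S "card H" "card K"
    unfolding S_def by (rule parallelogram_box_system[OF fin H K])
  define n h k m where "n = real (order G)" and "h = real (card H)" and "k = real (card K)"
    and "m = real (card S)"
  define \<gamma> where "\<gamma> = \<delta> / 16"
  define \<sigma> where "\<sigma> = (n ^ 4 / m) powr (1/3)"
  define s where "s = nat \<lceil>\<sigma>\<rceil>"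
  define s' where "s' = pick_factor \<delta> * s"
  define l where "l = 1 + 12 * real (rounds \<delta>) / \<delta>"
  have n_eq: "n = real (card (carrier G))" by (simp add: n_def order_def)
  have n: "0 < n" using card_V_pos by (simp add: n_eq)
  have hk: "0 < h" "0 < k" using H_large K_large by (auto simp: h_def k_def intro!: Nat.gr0I)
  have h_le: "h \<le> n"
    using card_mono[OF fin subgroup.subset[OF H]] by (simp add: h_def n_eq)
  have m: "0 < m"
  proof (rule ccontr)
    assume "\<not> 0 < m"
    then have "m = 0" by (simp add: m_def)
    \<comment> \<open>\<open>0 powr (2/3)\<close> is 0, whereas the maximum is positive.\<close>
    then show False using max hk by (simp add: m_def h_def k_def)
  qed
  have "real (card S) \<le> real (order G * card H * card K)"
    using card_distinct_parallelograms_le[OF fin H K] by (simp only: S_def of_nat_le_iff)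
  then have m_le: "m \<le> n * (h * k)" by (simp add: m_def n_def h_def k_def mult.assoc)
  then have mn: "m / n \<le> h * k" using n by (simp add: divide_le_eq mult.commute)
  \<comment> \<open>Cubing the condition on the maximum and using \<open>m / n \<le> h * k\<close>
    shows that neither subgroup is larger than the square of the other.\<close>
  have cube: "x ^ 3 \<le> (h * k)\<^sup>2" if "x = h \<or> x = k" for x
  proof -
    have "x ^ 3 \<le> ((m / n) powr (2/3)) ^ 3"
      using max that hk by (intro power_mono) (auto simp: h_def k_def m_def n_def)
    also have "\<dots> = (m / n)\<^sup>2" using m n by (intro powr_third_power3) auto
    also have "\<dots> \<le> (h * k)\<^sup>2" using mn m n by (intro power_mono) auto
    finally show ?thesis .
  qed
  have "k * k\<^sup>2 \<le> h\<^sup>2 * k\<^sup>2" using cube[of k] by (simp add: power3_eq_cube power2_eq_square mult_ac)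
  then have k_le: "k \<le> h\<^sup>2" using hk by (simp add: mult_le_cancel_right_pos)
  have "h * h\<^sup>2 \<le> k\<^sup>2 * h\<^sup>2" using cube[of h] by (simp add: power3_eq_cube power2_eq_square mult_ac)
  then have h_le': "h \<le> k\<^sup>2" using hk by (simp add: mult_le_cancel_right_pos)
  have \<sigma>3: "\<sigma> ^ 3 = n ^ 4 / m" unfolding \<sigma>_def using m n by (intro powr_third_power3) auto
  \<comment> \<open>Used with \<open>c\<close> equal to \<open>h ^ 3\<close> and
    \<open>k ^ 3\<close> for the row and column conditions on \<open>s\<close>, and with
    \<open>h * k\<close> itself for the third pick.\<close>
  have \<sigma>_hk: "n ^ 3 \<le> \<sigma> ^ 3 * c" if "h * k \<le> c" for c
  proof -
    have "n ^ 3 * m \<le> n ^ 3 * (n * c)"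
      using m_le that n by (intro mult_left_mono order_trans[OF m_le]) auto
    also have "\<dots> = n ^ 4 * c" by (simp add: power_numeral_reduce)
    finally have "n ^ 3 \<le> n ^ 4 * c / m" using m by (simp add: pos_le_divide_eq)
    then show ?thesis by (simp add: \<sigma>3)
  qed
  have \<sigma>0: "0 \<le> \<sigma>" by (simp add: \<sigma>_def)
  have "h * k \<le> h * h\<^sup>2" "k * h \<le> k * k\<^sup>2"
    using k_le h_le' hk by (intro mult_left_mono; simp)+
  then have "h * k \<le> h ^ 3" "h * k \<le> k ^ 3"
    by (simp_all add: power3_eq_cube power2_eq_square mult.commute)
  then have "n ^ 3 \<le> (\<sigma> * h) ^ 3" "n ^ 3 \<le> (\<sigma> * k) ^ 3"
    by (auto intro: \<sigma>_hk simp: power_mult_distrib)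
  then have n_le: "n \<le> \<sigma> * h" "n \<le> \<sigma> * k"
    using \<sigma>0 hk by (auto intro: power_le_imp_le_base[of n 2] simp: numeral_3_eq_3 numeral_2_eq_2)
  have "1 * h \<le> \<sigma> * h" using n_le h_le by linarith
  then have \<sigma>1: "1 \<le> \<sigma>" using hk by (simp only: mult_le_cancel_right_pos)
  have s: "\<sigma> \<le> s" "s \<le> 2 * \<sigma>" using \<sigma>1 unfolding s_def by linarith+
  have c: "0 < box_density \<delta>" "box_density \<delta> \<le> 1"
    "1 \<le> rounds \<delta> * shrink (box_density \<delta>)" "0 < rounds \<delta>"
    "48 \<le> box_density \<delta> * pick_factor \<delta>" "0 < pick_factor \<delta>" "0 < threshold \<delta>"
    using constants[OF \<delta>] by auto
  have l: "0 \<le> ln l" unfolding l_def using \<delta> by (intro ln_ge_zero) auto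
  have t': "12 * rounds \<delta> * pick_factor \<delta> * (1 + ln l) * \<sigma> < t"
    using t \<delta> by (simp add: threshold_def l_def \<sigma>_def n_def m_def)
  have s'_le: "6 * rounds \<delta> * s' \<le> 12 * rounds \<delta> * pick_factor \<delta> * \<sigma>"
  proof -
    have "6 * rounds \<delta> * real (pick_factor \<delta>) * s \<le> 6 * rounds \<delta> * real (pick_factor \<delta>) * (2 * \<sigma>)"
      using s by (intro mult_left_mono) auto
    then show ?thesis by (simp add: s'_def)
  qed
  have t1: "6 * rounds \<delta> * s' \<le> t" and t2: "6 * rounds \<delta> * s' * ln l \<le> t"
  proof -
    have "12 * rounds \<delta> * pick_factor \<delta> * \<sigma> * 1 \<le> 12 * rounds \<delta> * pick_factor \<delta> * \<sigma> * (1 + ln l)"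
      using l \<sigma>0 by (intro mult_left_mono) auto
    then have "real (6 * rounds \<delta> * s') \<le> t" using s'_le t' by (simp add: mult_ac)
    then show "6 * rounds \<delta> * s' \<le> t" by (simp only: of_nat_le_iff)
    have "6 * rounds \<delta> * s' * ln l \<le> 12 * rounds \<delta> * pick_factor \<delta> * \<sigma> * ln l"
      using l s'_le by (intro mult_right_mono) auto
    also have "\<dots> \<le> 12 * rounds \<delta> * pick_factor \<delta> * \<sigma> * (1 + ln l)"
      using \<sigma>0 by (intro mult_left_mono) auto
    finally show "6 * rounds \<delta> * s' * ln l \<le> t" using t' by (simp add: mult_ac)
  qed
  \<comment> \<open>A set of density \<open>\<delta> / 16\<close> spans at least the fraction
    \<open>(\<delta> / 16) ^ 4\<close> of all parallelograms. At most half of these are degenerate,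
    hence the division by 2 in \<open>box_density\<close>.\<close>
  have dense: "box_density \<delta> * (real (card (carrier G)) * card H * card K)
      \<le> card (S \<inter> A \<times> A \<times> A \<times> A)"
    if A: "A \<subseteq> carrier G" "\<delta> / 16 * card (carrier G) \<le> card A" for A
  proof -
    define P where "P = {(x, a, b) \<in> carrier G \<times> H \<times> K.
      x \<in> A \<and> x \<otimes> a \<in> A \<and> x \<otimes> b \<in> A \<and> x \<otimes> a \<otimes> b \<in> A}"
    have "real (card H * card K * card A ^ 4) \<le> real (order G ^ 3 * card P)"
      using card_parallelograms_ge[OF fin H K A(1)] by (simp only: P_def of_nat_le_iff)
    then have P: "h * k * card A ^ 4 \<le> n ^ 3 * card P" by (simp add: h_def k_def n_def)
    have "(\<gamma> * n) ^ 4 \<le> card A ^ 4"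
      unfolding of_nat_power using A(2) \<delta> n by (intro power_mono) (auto simp: \<gamma>_def n_eq)
    then have "h * k * (\<gamma> * n) ^ 4 \<le> h * k * card A ^ 4"
      using hk by (intro mult_left_mono) auto
    then have "n ^ 3 * (\<gamma> ^ 4 * (n * (h * k))) \<le> n ^ 3 * card P"
      using P by (simp add: power_mult_distrib power_numeral_reduce mult_ac)
    then have P_ge: "\<gamma> ^ 4 * (n * (h * k)) \<le> card P" using n by (simp add: mult_le_cancel_left_pos)
    have "real (card P) \<le> real (card (S \<inter> A \<times> A \<times> A \<times> A) + order G * (card K + 3 * card H))"
      using card_distinct_parallelograms_ge[OF fin H K, of A] unfolding P_def S_def of_nat_le_iff .
    then have "card P \<le> card (S \<inter> A \<times> A \<times> A \<times> A) + n * (k + 3 * h)"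
      by (simp add: n_def h_def k_def)
    moreover have "n * (k + 3 * h) \<le> \<gamma> ^ 4 * (n * (h * k)) / 2"
    proof -
      \<comment> \<open>The 8 in the largeness assumptions: \<open>k + 3 * h\<close> is at most one
        eighth plus three eighths of \<open>\<gamma> ^ 4 * (h * k)\<close>.\<close>
      have "8 * k \<le> (\<gamma> ^ 4 * h) * k" "8 * h \<le> (\<gamma> ^ 4 * k) * h"
        using H_large K_large hk by (auto intro!: mult_right_mono simp: \<gamma>_def h_def k_def)
      then have "k + 3 * h \<le> \<gamma> ^ 4 * (h * k) / 2" by (simp add: mult_ac)
      then have "n * (k + 3 * h) \<le> n * (\<gamma> ^ 4 * (h * k) / 2)" using n by (intro mult_left_mono) auto
      then show ?thesis by (simp add: mult_ac)
    qed
    ultimately have "\<gamma> ^ 4 * (n * (h * k)) / 2 \<le> card (S \<inter> A \<times> A \<times> A \<times> A)"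
      using P_ge by linarith
    then show ?thesis by (simp add: box_density_def \<gamma>_def n_eq h_def k_def mult_ac)
  qed
  have "card (avoiding_sets (carrier G) S t) \<le> floor_choose (2 * \<delta> * real (card (carrier G))) t"
  proof (rule card_avoiding_sets_le[OF dense c(1,2) \<delta>(1) _ c(3)])
    show "1 \<le> \<delta> * card (carrier G)" using order_large by (simp add: order_def)
    have "\<sigma> * h \<le> s * h" "\<sigma> * k \<le> s * k" using s hk by (auto intro: mult_right_mono)
    then have "real (card (carrier G)) \<le> real (s * card H)" "real (card (carrier G)) \<le> real (s * card K)"
      using n_le by (auto simp: n_eq h_def k_def)
    then show "card (carrier G) \<le> s * card H" "card (carrier G) \<le> s * card K"
      by (simp_all only: of_nat_le_iff)
    have "n ^ 3 \<le> \<sigma> ^ 3 * (h * k)" by (rule \<sigma>_hk) simp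
    also have "\<dots> \<le> s ^ 3 * (h * k)"
      using s \<sigma>0 hk by (intro mult_right_mono) (auto intro: power_mono)
    finally have "real (card (carrier G) ^ 3) \<le> real (s ^ 3 * card H * card K)"
      by (simp add: n_eq h_def k_def mult.assoc)
    then show "card (carrier G) ^ 3 \<le> s ^ 3 * card H * card K" by (simp only: of_nat_le_iff)
    show "s \<le> s'" using c(6) by (simp add: s'_def)
    have "48 * real s \<le> box_density \<delta> * pick_factor \<delta> * real s" using c(5) by (intro mult_right_mono) auto
    then show "48 * real s \<le> box_density \<delta> * s'" by (simp add: s'_def mult.assoc)
    show "6 * rounds \<delta> * s' \<le> t" by (rule t1)
    show "6 * rounds \<delta> * s' * ln (1 + 12 * real (rounds \<delta>) / \<delta>) \<le> t"
      using t2 by (simp only: l_def)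
  qed
  then show ?thesis by (simp add: order_def)
qed

theorem theorem6p8:
  fixes \<delta> :: real
  assumes "0 < \<delta>" and "\<delta> < 1/40"
  shows "\<exists>C::real. C > 0 \<and>
    (\<forall>(G :: nat \<Rightarrow> 'a monoid) H K.
      (\<forall>i\<ge>1. comm_group (G i) \<and> finite (carrier (G i)) \<and>
              subgroup (H i) (G i) \<and> subgroup (K i) (G i)) \<longrightarrow>
      filterlim (\<lambda>i. card (H i)) at_top sequentially \<longrightarrow>
      filterlim (\<lambda>i. card (K i)) at_top sequentially \<longrightarrow>
      filterlim (\<lambda>i. order (G i)) at_top sequentially \<longrightarrow>
      (\<forall>i\<ge>1. real (max (card (H i)) (card (K i))) \<le>
         (real (card (distinct_tuples (parallelograms (G i) (H i) (K i))))
            / real (order (G i))) powr (2/3)) \<longrightarrow>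
      (\<exists>i\<^sub>0\<ge>1. \<forall>i\<ge>i\<^sub>0. \<forall>t::nat.
         real t > C / \<delta> *
           (real (order (G i)) ^ 4
              / real (card (distinct_tuples (parallelograms (G i) (H i) (K i))))) powr (1/3) \<longrightarrow>
         card (avoiding_sets (carrier (G i))
                 (distinct_tuples (parallelograms (G i) (H i) (K i))) t)
           \<le> floor_choose (2 * \<delta> * real (order (G i))) t))"
\<comment> \<open>\<open>C\<close> is a function of \<open>\<delta>\<close> alone; only the starting
  index depends on the family.\<close>
proof (intro exI[of _ "threshold \<delta>"] conjI allI impI)
  have \<delta>: "0 < \<delta>" "\<delta> < 1" using assms by auto
  then show "0 < threshold \<delta>" by (rule constants)
  fix G :: "nat \<Rightarrow> 'a monoid" and H K
  assume G: "\<forall>i\<ge>1. comm_group (G i) \<and> finite (carrier (G i)) \<and>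
              subgroup (H i) (G i) \<and> subgroup (K i) (G i)"
    and lim: "filterlim (\<lambda>i. card (H i)) at_top sequentially"
      "filterlim (\<lambda>i. card (K i)) at_top sequentially"
      "filterlim (\<lambda>i. order (G i)) at_top sequentially"
    and max: "\<forall>i\<ge>1. real (max (card (H i)) (card (K i))) \<le>
         (real (card (distinct_tuples (parallelograms (G i) (H i) (K i))))
            / real (order (G i))) powr (2/3)"
  have large: "\<forall>\<^sub>F i in sequentially. c \<le> d * real (f i)"
    if "filterlim f at_top sequentially" "0 < d" for f :: "nat \<Rightarrow> nat" and c d :: real
  proof -
    have "\<forall>\<^sub>F i in sequentially. nat \<lceil>c / d\<rceil> \<le> f i" using that(1) unfolding filterlim_at_top by blast
    then show ?thesis
    proof eventually_elim
      case (elim i)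
      have "c / d \<le> real (nat \<lceil>c / d\<rceil>)" by (rule real_nat_ceiling_ge)
      also have "\<dots> \<le> real (f i)" using elim by simp
      finally show ?case using that(2) by (simp add: divide_le_eq mult.commute)
    qed
  qed
  have pos: "0 < (\<delta> / 16) ^ 4" using \<delta> by simp
  \<comment> \<open>Beyond some index the degenerate parallelograms are negligible and rounding
    \<open>2 * \<delta> * order (G i)\<close> is harmless.\<close>
  have "\<forall>\<^sub>F i in sequentially. 8 \<le> (\<delta> / 16) ^ 4 * real (card (H i)) \<and>
      8 \<le> (\<delta> / 16) ^ 4 * real (card (K i)) \<and> 1 \<le> \<delta> * real (order (G i))"
    by (intro eventually_conj large lim pos \<delta>)
  then obtain N where N: "\<And>i. N \<le> i \<Longrightarrow> 8 \<le> (\<delta> / 16) ^ 4 * real (card (H i)) \<and>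
      8 \<le> (\<delta> / 16) ^ 4 * real (card (K i)) \<and> 1 \<le> \<delta> * real (order (G i))"
    unfolding eventually_sequentially by blast
  show "\<exists>i\<^sub>0\<ge>1. \<forall>i\<ge>i\<^sub>0. \<forall>t::nat.
         real t > threshold \<delta> / \<delta> *
           (real (order (G i)) ^ 4
              / real (card (distinct_tuples (parallelograms (G i) (H i) (K i))))) powr (1/3) \<longrightarrow>
         card (avoiding_sets (carrier (G i))
                 (distinct_tuples (parallelograms (G i) (H i) (K i))) t)
           \<le> floor_choose (2 * \<delta> * real (order (G i))) t"
  \<comment> \<open>The maximum with 1 is taken because the family is constrained only from index 1
    on.\<close>
  proof (intro exI[of _ "max 1 N"] conjI allI impI)
    fix i t
    assume i: "max 1 N \<le> i" and t: "real t > threshold \<delta> / \<delta> *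
           (real (order (G i)) ^ 4
              / real (card (distinct_tuples (parallelograms (G i) (H i) (K i))))) powr (1/3)"
    have "1 \<le> i" "N \<le> i" using i by auto
    then show "card (avoiding_sets (carrier (G i))
                 (distinct_tuples (parallelograms (G i) (H i) (K i))) t)
           \<le> floor_choose (2 * \<delta> * real (order (G i))) t"
      using G max N[of i] t \<delta> by (intro comm_group.card_avoiding_parallelograms_le) auto
  qed simp
qed

end
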